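(* Let $R$ be a ring, $M$ an $R$-module, $S\subseteq S'$ two saturated multiplicatively closed subsets of $R$, and $T=S^{-1}S'=\{s'/s : s'\in S', s\in S\}\subseteq R_S$. Suppose that $S$ splits $M$ and $S\cap Z(M)=S\cap Z(R)=\emptyset$. Let $\mathcal{P}$ be one of the following properties: having unique factorization, having finite factorization, being half factorial, having bounded factorization. Then $M$ has $\mathcal{P}$ with respect to $S'$ if and only if $M$ has $\mathcal{P}$ with respect to $S$ and the $R_S$-module $M_S$ has $\mathcal{P}$ with respect to $T$. If moreover $S'\setminus\mathrm{Ann}(M)$ (a subset of the $R$-module $R$) is compactly $S$-atomic, then likewise $M$ is $S'$-présimplifiable if and only if $M$ is $S$-présimplifiable and $M_S$ is $T$-présimplifiable.
   Context: All rings are commutative with identity and all modules are unitary and nonzero. $U(R)$ is the set of units of $R$. For $N\subseteq M$, $Z(N)=\{r\in R : \exists\, 0\neq m\in N,\ rm=0\}$ and $\mathrm{Ann}(N)=\{r\in R: rN=0\}$. A multiplicatively closed subset $S$ of $R$ (containing $1$) is saturated if $xy\in S$ implies $x,y\in S$; $S$ may contain $0$, which means $S=R$. $R_S$, $M_S$ denote localizations at $S$; $T$ is a saturated multiplicatively closed subset of $R_S$. The following notions are defined for any ring $R$, $R$-module $M$ and saturated multiplicatively closed $S\subseteq R$ (and applied also to $(R,M,S')$ and $(R_S,M_S,T)$). For $m,n\in M$, $m\sim^S n$ means there are $s,s'\in S$ with $m=sn$, $n=s'm$; for $S=R$ write $\sim$. An element $m\in M$ is $S$-primitive if $m=sn$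 with $s\in S$, $n\in M$ implies $n\sim^S m$. A nonunit $a\in R$ is irreducible if $a=bc$ with $b,c\in R$ implies $a\sim b$ or $a\sim c$ (in the $R$-module $R$). An $S$-factorization of $m\in M$ of length $k\ge 0$ is an equation $m=s_1\cdots s_kn$ with $s_i$ nonunits in $S$ and $n\in M$; it is an $S$-atomic factorization if every $s_i$ is irreducible and $n$ is $S$-primitive. $M$ is $S$-atomic if every nonzero element of $M$ has an $S$-atomic factorization. Two $S$-atomic factorizations $m=s_1\cdots s_kn=t_1\cdots t_ln'$ are isomorphic if $k=l$, $n\sim^S n'$, and for some permutation $\sigma$ of $\{1,\dots,k\}$, $s_i\sim t_{\sigma(i)}$ for all $i$. $M$ has unique (resp. finite) factorization with respect to $S$ if $M$ is $S$-atomic and every nonzero element of $M$ has exactly one (resp. finitely many) $S$-atomic factorization(s) up to isomorphism. $M$ is half factorial with respect to $S$ if $M$ is $S$-atomic and for each $0\neq m\in M$ all $S$-atomic factorizations of $m$ have the same length. $M$ has bounded factorization with respect to $S$ if for every $0\neq m\in M$ there is $N_m\in\mathbb{N}$ such that every $S$-factorization of $m$ has length at most $N_m$. $M$ is $S$-présimplifiable if $sm=m$ with $s\in S$, $m\in M$ implies $s\in U(R)$ or $m=0$. A compact $S$-atomic factorization of $m\in M$ is an equation $m=sn$ with $s\in S$ and $n\in M$ $S$-primitive. A subset $E\subseteq M$ is compactly $S$-atomic if every nonzero element of $E$ has a compact $S$-atomic factorization; $E$ is semi-$S$-factorable if moreover for every $0\neq m\in E$ and compact $S$-atomic factorizations $m=sn=s'n'$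 one has $s\sim s'$. $S$ splits $E$ if (i) $E$ is semi-$S$-factorable, and (ii) for every $S$-primitive $r\in R$ (in the $R$-module $R$) and every $S$-primitive $m\in M$ with $0\neq rm\in E$, the element $rm$ is $S$-primitive. *)

theory Defs
  imports "HOL-Algebra.Algebra" "HOL-Combinatorics.Permutations"
begin

section \<open>Preliminaries on rings and modules\<close>

text \<open>The ring \<open>R\<close> as a module over itself.\<close>

definition self_module :: "('a, 'c) ring_scheme \<Rightarrow> ('a, 'a) module"
  where "self_module R =
    \<lparr>carrier = carrier R, monoid.mult = monoid.mult R, one = one R,
     ring.zero = ring.zero R, ring.add = ring.add R, smult = monoid.mult R\<rparr>"

definition zero_divisors ::
    "('a, 'c) ring_scheme \<Rightarrow> ('a, 'm, 'd) module_scheme \<Rightarrow> 'm set \<Rightarrow> 'a set"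
  where "zero_divisors R M N =
    {r \<in> carrier R. \<exists>m\<in>N. m \<noteq> \<zero>\<^bsub>M\<^esub> \<and> r \<odot>\<^bsub>M\<^esub> m = \<zero>\<^bsub>M\<^esub>}"

definition annihilator ::
    "('a, 'c) ring_scheme \<Rightarrow> ('a, 'm, 'd) module_scheme \<Rightarrow> 'm set \<Rightarrow> 'a set"
  where "annihilator R M N = {r \<in> carrier R. \<forall>m\<in>N. r \<odot>\<^bsub>M\<^esub> m = \<zero>\<^bsub>M\<^esub>}"

definition saturated_mult :: "('a, 'c) ring_scheme \<Rightarrow> 'a set \<Rightarrow> bool"
  where "saturated_mult R S \<longleftrightarrow> submonoid S R \<and>
    (\<forall>x\<in>carrier R. \<forall>y\<in>carrier R. x \<otimes>\<^bsub>R\<^esub> y \<in> S \<longrightarrow> x \<in> S \<and> y \<in> S)"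

section \<open>Localization\<close>

text \<open>
  \<open>(m, s)\<close> and \<open>(n, t)\<close> give the same fraction iff \<open>u (t m) = u (s n)\<close> for some \<open>u \<in> S\<close>; the factor
  \<open>u\<close> is needed because \<open>S\<close> may in general contain zero divisors on \<open>M\<close>.
\<close>

definition loc_rel ::
    "('a, 'c) ring_scheme \<Rightarrow> ('a, 'm, 'd) module_scheme \<Rightarrow> 'a set \<Rightarrow> (('m \<times> 'a) \<times> ('m \<times> 'a)) set"
  where "loc_rel R M S =
    {((m, s), (n, t)). m \<in> carrier M \<and> s \<in> S \<and> n \<in> carrier M \<and> t \<in> S \<and>
       (\<exists>u\<in>S. u \<odot>\<^bsub>M\<^esub> (t \<odot>\<^bsub>M\<^esub> m) = u \<odot>\<^bsub>M\<^esub> (s \<odot>\<^bsub>M\<^esub> n))}"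

definition loc_frac ::
    "('a, 'c) ring_scheme \<Rightarrow> ('a, 'm, 'd) module_scheme \<Rightarrow> 'a set \<Rightarrow> 'm \<Rightarrow> 'a \<Rightarrow> ('m \<times> 'a) set"
  where "loc_frac R M S m s = loc_rel R M S `` {(m, s)}"

text \<open>
  The union over all representatives is the usual way to define an operation on classes: by
  \<open>loc_frac_add\<close> and \<open>loc_frac_smult\<close> below it is a union of copies of one and the same fraction.
  The ring fields \<open>mult\<close> and \<open>one\<close> of a module record carry no meaning.
\<close>

definition loc_module ::
    "('a, 'c) ring_scheme \<Rightarrow> ('a, 'm, 'd) module_scheme \<Rightarrow> 'a set
      \<Rightarrow> (('a \<times> 'a) set, ('m \<times> 'a) set) module"
  where "loc_module R M S =
    \<lparr>carrier = (carrier M \<times> S) // loc_rel R M S,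
     monoid.mult = undefined, one = undefined,
     ring.zero = loc_frac R M S \<zero>\<^bsub>M\<^esub> \<one>\<^bsub>R\<^esub>,
     ring.add = (\<lambda>A B. \<Union>(m, s)\<in>A. \<Union>(n, t)\<in>B.
       loc_frac R M S (t \<odot>\<^bsub>M\<^esub> m \<oplus>\<^bsub>M\<^esub> s \<odot>\<^bsub>M\<^esub> n) (s \<otimes>\<^bsub>R\<^esub> t)),
     smult = (\<lambda>A B. \<Union>(r, s)\<in>A. \<Union>(m, t)\<in>B. loc_frac R M S (r \<odot>\<^bsub>M\<^esub> m) (s \<otimes>\<^bsub>R\<^esub> t))\<rparr>"

definition loc_ring :: "('a, 'c) ring_scheme \<Rightarrow> 'a set \<Rightarrow> ('a \<times> 'a) set ring"
  where "loc_ring R S =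
    \<lparr>carrier = carrier (loc_module R (self_module R) S),
     monoid.mult = smult (loc_module R (self_module R) S),
     one = loc_frac R (self_module R) S \<one>\<^bsub>R\<^esub> \<one>\<^bsub>R\<^esub>,
     ring.zero = ring.zero (loc_module R (self_module R) S),
     ring.add = ring.add (loc_module R (self_module R) S)\<rparr>"

definition loc_subset :: "('a, 'c) ring_scheme \<Rightarrow> 'a set \<Rightarrow> 'a set \<Rightarrow> ('a \<times> 'a) set set"
  where "loc_subset R S S' = {loc_frac R (self_module R) S s' s | s' s. s' \<in> S' \<and> s \<in> S}"

section \<open>Factorization relative to \<open>S\<close>\<close>

definition S_sim ::
    "('a, 'm, 'd) module_scheme \<Rightarrow> 'a set \<Rightarrow> 'm \<Rightarrow> 'm \<Rightarrow> bool"
  where "S_sim M S m n \<longleftrightarrow> (\<exists>s\<in>S. \<exists>s'\<in>S. m = s \<odot>\<^bsub>M\<^esub> n \<and> n = s' \<odot>\<^bsub>M\<^esub> m)"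

abbreviation ring_sim :: "('a, 'c) ring_scheme \<Rightarrow> 'a \<Rightarrow> 'a \<Rightarrow> bool"
  where "ring_sim R \<equiv> S_sim (self_module R) (carrier R)"

definition S_primitive ::
    "('a, 'm, 'd) module_scheme \<Rightarrow> 'a set \<Rightarrow> 'm \<Rightarrow> bool"
  where "S_primitive M S m \<longleftrightarrow> m \<in> carrier M \<and>
    (\<forall>s\<in>S. \<forall>n\<in>carrier M. m = s \<odot>\<^bsub>M\<^esub> n \<longrightarrow> S_sim M S n m)"

text \<open>
  This is weaker than \<open>Divisibility.irreducible\<close>: for instance \<open>0\<close> is irreducible here in
  every domain.
\<close>

definition irred :: "('a, 'c) ring_scheme \<Rightarrow> 'a \<Rightarrow> bool"
  where "irred R a \<longleftrightarrow> a \<in> carrier R - Units R \<and>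
    (\<forall>b\<in>carrier R. \<forall>c\<in>carrier R. a = b \<otimes>\<^bsub>R\<^esub> c \<longrightarrow> ring_sim R a b \<or> ring_sim R a c)"

text \<open>
  A factorization \<open>m = s\<^sub>1 \<cdots> s\<^sub>k n\<close> is the pair of the list \<open>[s\<^sub>1, \<dots>, s\<^sub>k]\<close> and \<open>n\<close>; its length
  is that of the list.
\<close>

definition S_factorizations ::
    "('a, 'c) ring_scheme \<Rightarrow> ('a, 'm, 'd) module_scheme \<Rightarrow> 'a set \<Rightarrow> 'm \<Rightarrow> ('a list \<times> 'm) set"
  where "S_factorizations R M S m =
    {(ss, n). set ss \<subseteq> S - Units R \<and> n \<in> carrier M \<and>
       m = foldr (\<otimes>\<^bsub>R\<^esub>) ss \<one>\<^bsub>R\<^esub> \<odot>\<^bsub>M\<^esub> n}"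

definition S_atomic_factorizations ::
    "('a, 'c) ring_scheme \<Rightarrow> ('a, 'm, 'd) module_scheme \<Rightarrow> 'a set \<Rightarrow> 'm \<Rightarrow> ('a list \<times> 'm) set"
  where "S_atomic_factorizations R M S m =
    {(ss, n) \<in> S_factorizations R M S m. (\<forall>s\<in>set ss. irred R s) \<and> S_primitive M S n}"

definition S_atomic ::
    "('a, 'c) ring_scheme \<Rightarrow> ('a, 'm, 'd) module_scheme \<Rightarrow> 'a set \<Rightarrow> bool"
  where "S_atomic R M S \<longleftrightarrow>
    (\<forall>m\<in>carrier M - {\<zero>\<^bsub>M\<^esub>}. S_atomic_factorizations R M S m \<noteq> {})"

definition isomorphic_factorizations ::
    "('a, 'c) ring_scheme \<Rightarrow> ('a, 'm, 'd) module_scheme \<Rightarrow> 'a set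
      \<Rightarrow> 'a list \<times> 'm \<Rightarrow> 'a list \<times> 'm \<Rightarrow> bool"
  where "isomorphic_factorizations R M S = (\<lambda>(ss, n) (ts, n').
    length ss = length ts \<and> S_sim M S n n' \<and>
    (\<exists>\<sigma>. \<sigma> permutes {..<length ss} \<and> (\<forall>i<length ss. ring_sim R (ss ! i) (ts ! \<sigma> i))))"

definition unique_factorization ::
    "('a, 'c) ring_scheme \<Rightarrow> ('a, 'm, 'd) module_scheme \<Rightarrow> 'a set \<Rightarrow> bool"
  where "unique_factorization R M S \<longleftrightarrow> S_atomic R M S \<and>
    (\<forall>m\<in>carrier M - {\<zero>\<^bsub>M\<^esub>}. \<forall>f\<in>S_atomic_factorizations R M S m.
       \<forall>g\<in>S_atomic_factorizations R M S m. isomorphic_factorizations R M S f g)"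

definition finite_factorization ::
    "('a, 'c) ring_scheme \<Rightarrow> ('a, 'm, 'd) module_scheme \<Rightarrow> 'a set \<Rightarrow> bool"
  where "finite_factorization R M S \<longleftrightarrow> S_atomic R M S \<and>
    (\<forall>m\<in>carrier M - {\<zero>\<^bsub>M\<^esub>}.
       finite (S_atomic_factorizations R M S m //
         {(f, g). f \<in> S_atomic_factorizations R M S m \<and> g \<in> S_atomic_factorizations R M S m \<and>
                  isomorphic_factorizations R M S f g}))"

definition half_factorial ::
    "('a, 'c) ring_scheme \<Rightarrow> ('a, 'm, 'd) module_scheme \<Rightarrow> 'a set \<Rightarrow> bool"
  where "half_factorial R M S \<longleftrightarrow> S_atomic R M S \<and>
    (\<forall>m\<in>carrier M - {\<zero>\<^bsub>M\<^esub>}. \<forall>(ss, n)\<in>S_atomic_factorizations R M S m.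
       \<forall>(ts, n')\<in>S_atomic_factorizations R M S m. length ss = length ts)"

definition bounded_factorization ::
    "('a, 'c) ring_scheme \<Rightarrow> ('a, 'm, 'd) module_scheme \<Rightarrow> 'a set \<Rightarrow> bool"
  where "bounded_factorization R M S \<longleftrightarrow>
    (\<forall>m\<in>carrier M - {\<zero>\<^bsub>M\<^esub>}. \<exists>N::nat.
       \<forall>(ss, n)\<in>S_factorizations R M S m. length ss \<le> N)"

definition presimplifiable ::
    "('a, 'c) ring_scheme \<Rightarrow> ('a, 'm, 'd) module_scheme \<Rightarrow> 'a set \<Rightarrow> bool"
  where "presimplifiable R M S \<longleftrightarrow>
    (\<forall>s\<in>S. \<forall>m\<in>carrier M. s \<odot>\<^bsub>M\<^esub> m = m \<longrightarrow> s \<in> Units R \<or> m = \<zero>\<^bsub>M\<^esub>)"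

section \<open>Splitting sets\<close>

definition compact_atomic_factorizations ::
    "('a, 'm, 'd) module_scheme \<Rightarrow> 'a set \<Rightarrow> 'm \<Rightarrow> ('a \<times> 'm) set"
  where "compact_atomic_factorizations M S m =
    {(s, n). s \<in> S \<and> S_primitive M S n \<and> m = s \<odot>\<^bsub>M\<^esub> n}"

definition compactly_atomic ::
    "('a, 'm, 'd) module_scheme \<Rightarrow> 'a set \<Rightarrow> 'm set \<Rightarrow> bool"
  where "compactly_atomic M S E \<longleftrightarrow>
    (\<forall>m\<in>E - {\<zero>\<^bsub>M\<^esub>}. compact_atomic_factorizations M S m \<noteq> {})"

definition semi_factorable ::
    "('a, 'c) ring_scheme \<Rightarrow> ('a, 'm, 'd) module_scheme \<Rightarrow> 'a set \<Rightarrow> 'm set \<Rightarrow> bool"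
  where "semi_factorable R M S E \<longleftrightarrow> compactly_atomic M S E \<and>
    (\<forall>m\<in>E - {\<zero>\<^bsub>M\<^esub>}. \<forall>(s, n)\<in>compact_atomic_factorizations M S m.
       \<forall>(s', n')\<in>compact_atomic_factorizations M S m. ring_sim R s s')"

definition splits ::
    "('a, 'c) ring_scheme \<Rightarrow> ('a, 'm, 'd) module_scheme \<Rightarrow> 'a set \<Rightarrow> 'm set \<Rightarrow> bool"
  where "splits R M S E \<longleftrightarrow> semi_factorable R M S E \<and>
    (\<forall>r m. S_primitive (self_module R) S r \<longrightarrow> S_primitive M S m \<longrightarrow>
       r \<odot>\<^bsub>M\<^esub> m \<in> E \<longrightarrow> r \<odot>\<^bsub>M\<^esub> m \<noteq> \<zero>\<^bsub>M\<^esub> \<longrightarrow> S_primitive M S (r \<odot>\<^bsub>M\<^esub> m))"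

section \<open>The localizations are a ring and a module\<close>

locale module_loc = module R M + submonoid S R
  for R (structure) and M (structure) and S
begin

lemma S_R [simp, intro]: "s \<in> S \<Longrightarrow> s \<in> carrier R"
  using subset by blast

lemma smult_swap:
  "\<lbrakk>a \<in> carrier R; b \<in> carrier R; x \<in> carrier M\<rbrakk> \<Longrightarrow> a \<odot>\<^bsub>M\<^esub> (b \<odot>\<^bsub>M\<^esub> x) = b \<odot>\<^bsub>M\<^esub> (a \<odot>\<^bsub>M\<^esub> x)"
  by (simp flip: smult_assoc1 add: m_comm)

lemma equiv_loc_rel: "equiv (carrier M \<times> S) (loc_rel R M S)"
proof (rule equivI)
  show "loc_rel R M S \<subseteq> (carrier M \<times> S) \<times> (carrier M \<times> S)"
    by (auto simp: loc_rel_def)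
  show "refl_on (carrier M \<times> S) (loc_rel R M S)"
    by (auto simp: refl_on_def loc_rel_def)
  show "sym (loc_rel R M S)"
    by (auto simp: sym_def loc_rel_def dest: sym)
  show "trans (loc_rel R M S)"
  proof (rule transI, clarsimp simp: loc_rel_def)
    fix m s n t p v u w
    assume A: "m \<in> carrier M" "s \<in> S" "n \<in> carrier M" "t \<in> S" "p \<in> carrier M" "v \<in> S" "u \<in> S" "w \<in> S"
      and 1: "u \<odot>\<^bsub>M\<^esub> (t \<odot>\<^bsub>M\<^esub> m) = u \<odot>\<^bsub>M\<^esub> (s \<odot>\<^bsub>M\<^esub> n)"
      and 2: "w \<odot>\<^bsub>M\<^esub> (v \<odot>\<^bsub>M\<^esub> n) = w \<odot>\<^bsub>M\<^esub> (t \<odot>\<^bsub>M\<^esub> p)"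
    have "(u \<otimes> w \<otimes> t) \<odot>\<^bsub>M\<^esub> (v \<odot>\<^bsub>M\<^esub> m) = (w \<otimes> v) \<odot>\<^bsub>M\<^esub> (u \<odot>\<^bsub>M\<^esub> (t \<odot>\<^bsub>M\<^esub> m))"
      using A by (simp flip: smult_assoc1 add: m_ac)
    also have "\<dots> = (u \<otimes> s) \<odot>\<^bsub>M\<^esub> (w \<odot>\<^bsub>M\<^esub> (v \<odot>\<^bsub>M\<^esub> n))"
      unfolding 1 using A by (simp flip: smult_assoc1 add: m_ac)
    also have "\<dots> = (u \<otimes> w \<otimes> t) \<odot>\<^bsub>M\<^esub> (s \<odot>\<^bsub>M\<^esub> p)"
      unfolding 2 using A by (simp flip: smult_assoc1 add: m_ac)
    finally show "\<exists>x\<in>S. x \<odot>\<^bsub>M\<^esub> (v \<odot>\<^bsub>M\<^esub> m) = x \<odot>\<^bsub>M\<^esub> (s \<odot>\<^bsub>M\<^esub> p)"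
      using A by (meson m_closed)
  qed
qed

lemma loc_frac_eq_iff:
  assumes "m \<in> carrier M" "s \<in> S" "n \<in> carrier M" "t \<in> S"
  shows "loc_frac R M S m s = loc_frac R M S n t \<longleftrightarrow>
    (\<exists>u\<in>S. u \<odot>\<^bsub>M\<^esub> (t \<odot>\<^bsub>M\<^esub> m) = u \<odot>\<^bsub>M\<^esub> (s \<odot>\<^bsub>M\<^esub> n))"
  using eq_equiv_class_iff[OF equiv_loc_rel, of "(m, s)" "(n, t)"] assms
  by (simp add: loc_frac_def loc_rel_def)

lemma loc_frac_eqI:
  assumes "m \<in> carrier M" "s \<in> S" "n \<in> carrier M" "t \<in> S"
    and "t \<odot>\<^bsub>M\<^esub> m = s \<odot>\<^bsub>M\<^esub> n"
  shows "loc_frac R M S m s = loc_frac R M S n t"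
  using assms one_closed by (auto simp: loc_frac_eq_iff)

lemma carrier_loc_module:
  "carrier (loc_module R M S) = {loc_frac R M S m s | m s. m \<in> carrier M \<and> s \<in> S}"
  by (auto simp: loc_module_def quotient_def loc_frac_def)

lemma loc_frac_add:
  assumes "m \<in> carrier M" "s \<in> S" "n \<in> carrier M" "t \<in> S"
  shows "loc_frac R M S m s \<oplus>\<^bsub>loc_module R M S\<^esub> loc_frac R M S n t
    = loc_frac R M S (t \<odot>\<^bsub>M\<^esub> m \<oplus>\<^bsub>M\<^esub> s \<odot>\<^bsub>M\<^esub> n) (s \<otimes> t)"
proof -
  let ?f = "\<lambda>p q. loc_frac R M S (snd q \<odot>\<^bsub>M\<^esub> fst p \<oplus>\<^bsub>M\<^esub> snd p \<odot>\<^bsub>M\<^esub> fst q) (snd p \<otimes> snd q)"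
  have "congruent2 (loc_rel R M S) (loc_rel R M S) ?f"
  proof (rule congruent2I', clarsimp simp: loc_rel_def)
    fix m s m' s' n t n' t' u v
    assume A: "m \<in> carrier M" "s \<in> S" "m' \<in> carrier M" "s' \<in> S"
        "n \<in> carrier M" "t \<in> S" "n' \<in> carrier M" "t' \<in> S" "u \<in> S" "v \<in> S"
      and 1: "u \<odot>\<^bsub>M\<^esub> (s' \<odot>\<^bsub>M\<^esub> m) = u \<odot>\<^bsub>M\<^esub> (s \<odot>\<^bsub>M\<^esub> m')"
      and 2: "v \<odot>\<^bsub>M\<^esub> (t' \<odot>\<^bsub>M\<^esub> n) = v \<odot>\<^bsub>M\<^esub> (t \<odot>\<^bsub>M\<^esub> n')"
    have "(u \<otimes> v) \<odot>\<^bsub>M\<^esub> ((s' \<otimes> t') \<odot>\<^bsub>M\<^esub> (t \<odot>\<^bsub>M\<^esub> m \<oplus>\<^bsub>M\<^esub> s \<odot>\<^bsub>M\<^esub> n))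
      = (v \<otimes> t' \<otimes> t) \<odot>\<^bsub>M\<^esub> (u \<odot>\<^bsub>M\<^esub> (s' \<odot>\<^bsub>M\<^esub> m)) \<oplus>\<^bsub>M\<^esub> (u \<otimes> s' \<otimes> s) \<odot>\<^bsub>M\<^esub> (v \<odot>\<^bsub>M\<^esub> (t' \<odot>\<^bsub>M\<^esub> n))"
      using A by (simp flip: smult_assoc1 add: smult_r_distr m_ac)
    also have "\<dots> = (u \<otimes> v) \<odot>\<^bsub>M\<^esub> ((s \<otimes> t) \<odot>\<^bsub>M\<^esub> (t' \<odot>\<^bsub>M\<^esub> m' \<oplus>\<^bsub>M\<^esub> s' \<odot>\<^bsub>M\<^esub> n'))"
      unfolding 1 2 using A by (simp flip: smult_assoc1 add: smult_r_distr m_ac)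
    finally show "loc_frac R M S (t \<odot>\<^bsub>M\<^esub> m \<oplus>\<^bsub>M\<^esub> s \<odot>\<^bsub>M\<^esub> n) (s \<otimes> t)
      = loc_frac R M S (t' \<odot>\<^bsub>M\<^esub> m' \<oplus>\<^bsub>M\<^esub> s' \<odot>\<^bsub>M\<^esub> n') (s' \<otimes> t')"
      using A by (subst loc_frac_eq_iff) auto
  qed
  from UN_equiv_class2[OF equiv_loc_rel equiv_loc_rel this, of "(m, s)" "(n, t)"] assms
  show ?thesis by (simp add: loc_module_def loc_frac_def case_prod_beta)
qed

lemma module_self: "module R (self_module R)"
proof -
  have "abelian_group (self_module R)"
    by (rule abelian_groupI) (use R.l_neg in \<open>auto simp: self_module_def R.a_ac\<close>)
  then show ?thesis
    by (rule moduleI[OF R.is_cring])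
      (simp_all add: self_module_def R.l_distr R.r_distr R.m_assoc)
qed

lemma module_loc_self: "module_loc R (self_module R) S"
  by (simp add: module_loc_def module_self submonoid_axioms)

lemma loc_frac_smult:
  assumes "r \<in> carrier R" "s \<in> S" "m \<in> carrier M" "t \<in> S"
  shows "loc_frac R (self_module R) S r s \<odot>\<^bsub>loc_module R M S\<^esub> loc_frac R M S m t
    = loc_frac R M S (r \<odot>\<^bsub>M\<^esub> m) (s \<otimes> t)"
proof -
  interpret L: module_loc R "self_module R" S by (rule module_loc_self)
  let ?f = "\<lambda>p q. loc_frac R M S (fst p \<odot>\<^bsub>M\<^esub> fst q) (snd p \<otimes> snd q)"
  have "congruent2 (loc_rel R (self_module R) S) (loc_rel R M S) ?f"
  proof (rule congruent2I', clarsimp simp: loc_rel_def self_module_def)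
    fix r s r' s' m t m' t' u v
    assume A: "r \<in> carrier R" "s \<in> S" "r' \<in> carrier R" "s' \<in> S"
        "m \<in> carrier M" "t \<in> S" "m' \<in> carrier M" "t' \<in> S" "u \<in> S" "v \<in> S"
      and 1: "u \<otimes> (s' \<otimes> r) = u \<otimes> (s \<otimes> r')"
      and 2: "v \<odot>\<^bsub>M\<^esub> (t' \<odot>\<^bsub>M\<^esub> m) = v \<odot>\<^bsub>M\<^esub> (t \<odot>\<^bsub>M\<^esub> m')"
    have "(u \<otimes> v) \<odot>\<^bsub>M\<^esub> ((s' \<otimes> t') \<odot>\<^bsub>M\<^esub> (r \<odot>\<^bsub>M\<^esub> m))
      = (u \<otimes> (s' \<otimes> r)) \<odot>\<^bsub>M\<^esub> (v \<odot>\<^bsub>M\<^esub> (t' \<odot>\<^bsub>M\<^esub> m))"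
      using A by (simp flip: smult_assoc1 add: m_ac)
    also have "\<dots> = (u \<otimes> v) \<odot>\<^bsub>M\<^esub> ((s \<otimes> t) \<odot>\<^bsub>M\<^esub> (r' \<odot>\<^bsub>M\<^esub> m'))"
      unfolding 1 2 using A by (simp flip: smult_assoc1 add: m_ac)
    finally show "loc_frac R M S (r \<odot>\<^bsub>M\<^esub> m) (s \<otimes> t) = loc_frac R M S (r' \<odot>\<^bsub>M\<^esub> m') (s' \<otimes> t')"
      using A by (subst loc_frac_eq_iff) auto
  qed
  from UN_equiv_class2[OF L.equiv_loc_rel equiv_loc_rel this, of "(r, s)" "(m, t)"] assms
  show ?thesis by (simp add: loc_module_def loc_frac_def case_prod_beta self_module_def)
qed

lemma loc_frac_in_carrier [simp, intro]:
  "m \<in> carrier M \<Longrightarrow> s \<in> S \<Longrightarrow> loc_frac R M S m s \<in> carrier (loc_module R M S)"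
  by (auto simp: carrier_loc_module)

lemma abelian_group_loc_module: "abelian_group (loc_module R M S)"
proof (rule abelian_groupI)
  have Z: "\<zero>\<^bsub>loc_module R M S\<^esub> = loc_frac R M S \<zero>\<^bsub>M\<^esub> \<one>"
    by (simp add: loc_module_def)
  show "\<zero>\<^bsub>loc_module R M S\<^esub> \<in> carrier (loc_module R M S)"
    by (simp add: Z)
  fix x assume "x \<in> carrier (loc_module R M S)"
  then obtain m s where x: "x = loc_frac R M S m s" and m: "m \<in> carrier M" "s \<in> S"
    by (auto simp: carrier_loc_module)
  show "\<zero>\<^bsub>loc_module R M S\<^esub> \<oplus>\<^bsub>loc_module R M S\<^esub> x = x"
    using m by (simp add: x Z loc_frac_add)
  have "loc_frac R M S (\<ominus>\<^bsub>M\<^esub> m) s \<oplus>\<^bsub>loc_module R M S\<^esub> x = \<zero>\<^bsub>loc_module R M S\<^esub>"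
    unfolding x Z using m
    by (simp add: loc_frac_add smult_r_minus M.l_neg, intro loc_frac_eqI, auto)
  then show "\<exists>y\<in>carrier (loc_module R M S). y \<oplus>\<^bsub>loc_module R M S\<^esub> x = \<zero>\<^bsub>loc_module R M S\<^esub>"
    using m by blast
  fix y assume "y \<in> carrier (loc_module R M S)"
  then obtain n t where y: "y = loc_frac R M S n t" and n: "n \<in> carrier M" "t \<in> S"
    by (auto simp: carrier_loc_module)
  show "x \<oplus>\<^bsub>loc_module R M S\<^esub> y \<in> carrier (loc_module R M S)"
    using m n by (simp add: x y loc_frac_add)
  show "x \<oplus>\<^bsub>loc_module R M S\<^esub> y = y \<oplus>\<^bsub>loc_module R M S\<^esub> x"
    using m n by (simp add: x y loc_frac_add m_comm M.a_comm)
  fix z assume "z \<in> carrier (loc_module R M S)"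
  then obtain p v where z: "z = loc_frac R M S p v" and p: "p \<in> carrier M" "v \<in> S"
    by (auto simp: carrier_loc_module)
  show "x \<oplus>\<^bsub>loc_module R M S\<^esub> y \<oplus>\<^bsub>loc_module R M S\<^esub> z
    = x \<oplus>\<^bsub>loc_module R M S\<^esub> (y \<oplus>\<^bsub>loc_module R M S\<^esub> z)"
    using m n p
    by (simp add: x y z loc_frac_add smult_r_distr m_ac M.a_ac flip: smult_assoc1)
qed

end

context module_loc
begin

interpretation L: module_loc R "self_module R" S
  by (rule module_loc_self)

lemma self_module_simps [simp]:
  "carrier (self_module R) = carrier R" "smult (self_module R) = monoid.mult R"
  "ring.zero (self_module R) = \<zero>" "ring.add (self_module R) = ring.add R"
  by (simp_all add: self_module_def)

lemma loc_ring_mult: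
  assumes "r \<in> carrier R" "s \<in> S" "r' \<in> carrier R" "t \<in> S"
  shows "loc_frac R (self_module R) S r s \<otimes>\<^bsub>loc_ring R S\<^esub> loc_frac R (self_module R) S r' t
    = loc_frac R (self_module R) S (r \<otimes> r') (s \<otimes> t)"
  using L.loc_frac_smult[of r s r' t] assms by (simp add: loc_ring_def)

lemma loc_ring_add:
  assumes "r \<in> carrier R" "s \<in> S" "r' \<in> carrier R" "t \<in> S"
  shows "loc_frac R (self_module R) S r s \<oplus>\<^bsub>loc_ring R S\<^esub> loc_frac R (self_module R) S r' t
    = loc_frac R (self_module R) S (t \<otimes> r \<oplus> s \<otimes> r') (s \<otimes> t)"
  using L.loc_frac_add[of r s r' t] assms by (simp add: loc_ring_def)

lemma carrier_loc_ring:
  "carrier (loc_ring R S) = {loc_frac R (self_module R) S r s | r s. r \<in> carrier R \<and> s \<in> S}"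
  using L.carrier_loc_module by (simp add: loc_ring_def)

lemma cring_loc_ring: "cring (loc_ring R S)"
proof (rule cringI)
  interpret A: abelian_group "loc_module R (self_module R) S"
    by (rule L.abelian_group_loc_module)
  show "abelian_group (loc_ring R S)"
    by (rule abelian_groupI) (use A.l_neg in \<open>auto simp: loc_ring_def A.a_ac\<close>)
  have one: "\<one>\<^bsub>loc_ring R S\<^esub> = loc_frac R (self_module R) S \<one> \<one>"
    by (simp add: loc_ring_def)
  show "comm_monoid (loc_ring R S)"
    by (rule comm_monoidI)
      (auto simp: carrier_loc_ring one loc_ring_mult m_ac, (metis R.m_closed m_closed | metis R.one_closed one_closed)+)
  fix x y z assume "x \<in> carrier (loc_ring R S)" "y \<in> carrier (loc_ring R S)" "z \<in> carrier (loc_ring R S)"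
  then obtain a s b t c v where x: "x = loc_frac R (self_module R) S a s"
      and y: "y = loc_frac R (self_module R) S b t" and z: "z = loc_frac R (self_module R) S c v"
      and A: "a \<in> carrier R" "b \<in> carrier R" "c \<in> carrier R" "s \<in> S" "t \<in> S" "v \<in> S"
    by (auto simp: carrier_loc_ring)
  show "(x \<oplus>\<^bsub>loc_ring R S\<^esub> y) \<otimes>\<^bsub>loc_ring R S\<^esub> z
    = x \<otimes>\<^bsub>loc_ring R S\<^esub> z \<oplus>\<^bsub>loc_ring R S\<^esub> y \<otimes>\<^bsub>loc_ring R S\<^esub> z"
    using A unfolding x y z
    by (simp add: loc_ring_mult loc_ring_add) (intro L.loc_frac_eqI, simp_all add: l_distr r_distr m_ac)
qed

lemma module_loc_module: "module (loc_ring R S) (loc_module R M S)"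
proof (rule moduleI[OF cring_loc_ring abelian_group_loc_module])
  fix a x assume "a \<in> carrier (loc_ring R S)" "x \<in> carrier (loc_module R M S)"
  then obtain r s m t where a: "a = loc_frac R (self_module R) S r s" and x: "x = loc_frac R M S m t"
      and A: "r \<in> carrier R" "s \<in> S" "m \<in> carrier M" "t \<in> S"
    by (auto simp: carrier_loc_ring carrier_loc_module)
  show "a \<odot>\<^bsub>loc_module R M S\<^esub> x \<in> carrier (loc_module R M S)"
    using A by (simp add: a x loc_frac_smult)
  {
    fix b assume "b \<in> carrier (loc_ring R S)"
    then obtain r' s' where b: "b = loc_frac R (self_module R) S r' s'" and B: "r' \<in> carrier R" "s' \<in> S"
      by (auto simp: carrier_loc_ring)
    show "(a \<oplus>\<^bsub>loc_ring R S\<^esub> b) \<odot>\<^bsub>loc_module R M S\<^esub> x =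
        a \<odot>\<^bsub>loc_module R M S\<^esub> x \<oplus>\<^bsub>loc_module R M S\<^esub> b \<odot>\<^bsub>loc_module R M S\<^esub> x"
      using A B unfolding a b x
      by (simp add: loc_ring_add loc_frac_smult loc_frac_add)
        (intro loc_frac_eqI, simp_all add: smult_l_distr smult_r_distr m_ac flip: smult_assoc1)
    show "(a \<otimes>\<^bsub>loc_ring R S\<^esub> b) \<odot>\<^bsub>loc_module R M S\<^esub> x =
        a \<odot>\<^bsub>loc_module R M S\<^esub> (b \<odot>\<^bsub>loc_module R M S\<^esub> x)"
      using A B by (simp add: a b x loc_ring_mult loc_frac_smult smult_assoc1 m_assoc)
  }
  {
    fix y assume "y \<in> carrier (loc_module R M S)"
    then obtain n v where y: "y = loc_frac R M S n v" and B: "n \<in> carrier M" "v \<in> S"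
      by (auto simp: carrier_loc_module)
    show "a \<odot>\<^bsub>loc_module R M S\<^esub> (x \<oplus>\<^bsub>loc_module R M S\<^esub> y) =
        a \<odot>\<^bsub>loc_module R M S\<^esub> x \<oplus>\<^bsub>loc_module R M S\<^esub> a \<odot>\<^bsub>loc_module R M S\<^esub> y"
      using A B unfolding a x y
      by (simp add: loc_frac_smult loc_frac_add)
        (intro loc_frac_eqI, simp_all add: smult_r_distr m_ac flip: smult_assoc1)
  }
next
  fix x assume "x \<in> carrier (loc_module R M S)"
  then obtain m t where x: "x = loc_frac R M S m t" and A: "m \<in> carrier M" "t \<in> S"
    by (auto simp: carrier_loc_module)
  show "\<one>\<^bsub>loc_ring R S\<^esub> \<odot>\<^bsub>loc_module R M S\<^esub> x = x"
    using A loc_frac_smult[of \<one> \<one> m t] by (simp add: x loc_ring_def)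
qed

end

end

theory Submission
  imports Defs
begin

text \<open>
  Since \<open>S\<close> splits \<open>M\<close>, every nonzero element of \<open>M\<close> is \<open>s p\<close> with \<open>s \<in> S\<close> and \<open>p\<close> primitive, both
  unique up to units of \<open>R\<close>. An irreducible of \<open>R\<close> that lies neither in \<open>S\<close> nor in \<open>Ann(M)\<close> is
  itself primitive, and it carries primitive elements to primitive elements or to \<open>0\<close>. Hence an
  atomic factorization of \<open>m = s p\<close> with respect to \<open>S'\<close> amounts to an \<open>S\<close>-atomic factorization of
  \<open>m\<close> together with an \<open>S'\<close>-atomic factorization of \<open>p\<close>, all of whose factors are primitive.

  Each of the four properties with respect to \<open>S\<close> bounds the lengths of \<open>S\<close>-factorizations, so that
  every element of \<open>R - Ann(M)\<close> also is a product of an element of \<open>S\<close> and a primitive one. Then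
  divisibility, irreducibility and primitivity of fractions are those of their primitive parts, and
  \<open>T\<close>-factorizations of \<open>m/1\<close> correspond to \<open>S'\<close>-factorizations of \<open>p\<close>.
\<close>

text \<open>Splitting factors the elements of \<open>M\<close>, but the localization also needs
  scalars to break up into a part in \<open>S\<close> and a primitive part. A length bound provides
  this: fix \<open>m\<close> with \<open>a m\<close> nonzero; every nonunit of \<open>S\<close>
  taken out of \<open>a\<close> lengthens an \<open>S\<close>-factorization of \<open>a m\<close>,
  so the process stops. Presimplifiability with respect to \<open>S\<close> already follows from
  splitting and gives no such bound; this is why the last claim comes with a compactness hypothesis.
  Outside \<open>S\<close> there may be zero divisors, so only elements of \<open>S\<close> are ever
  cancelled, products of primitive elements may vanish, and scalars are studied through their action
  on a primitive element that they do not kill. The pivot is the property with respect to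
  \<open>S'\<close> restricted to primitive elements: splitting off the part in \<open>S\<close>
  joins it to the property for \<open>S\<close>, and passing to fractions identifies it with the
  property of \<open>M_S\<close>. The three counting properties are treated at once, through sets of
  isomorphism types. Bounded factorization is not about atomic factorizations and has its own
  argument.\<close>

section \<open>Isomorphism types of factorizations\<close>

text \<open>With \<open>k\<close> true this means at most one element, with \<open>k\<close> false
  just finiteness, so that uniqueness, equal length and finiteness share one transfer
  argument.\<close>

definition few :: "bool \<Rightarrow> 'b set \<Rightarrow> bool"
  where "few k A \<longleftrightarrow> finite A \<and> (k \<longrightarrow> (\<forall>x\<in>A. \<forall>y\<in>A. x = y))"

lemma few_True_image_iff: "few True (f ` A) \<longleftrightarrow> (\<forall>x\<in>A. \<forall>y\<in>A. f x = f y)"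
proof (cases "A = {}")
  case False
  then obtain a where a: "a \<in> A"
    by blast
  have "finite (f ` A)" if eq: "\<forall>x\<in>A. \<forall>y\<in>A. f x = f y"
  proof (rule finite_subset)
    show "f ` A \<subseteq> {f a}"
      unfolding image_subset_iff singleton_iff by (intro ballI eq[rule_format] a)
  qed simp
  then show ?thesis
    unfolding few_def ball_simps by iprover
qed (simp add: few_def)

lemma few_subset: "few k B \<Longrightarrow> A \<subseteq> B \<Longrightarrow> few k A"
  unfolding few_def by (meson finite_subset subsetD)

lemma few_Times: "few k A \<Longrightarrow> few k B \<Longrightarrow> few k (A \<times> B)"
  unfolding few_def by auto

text \<open>By \<open>inj\<close> the value of \<open>i\<close> on \<open>A\<close> is a function of
  \<open>j (h x)\<close>, so the image of \<open>A\<close> under \<open>i\<close> is an image of a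
  subset of the image of \<open>B\<close> under \<open>j\<close>. The map \<open>h\<close> may be
  any choice function; it need not be injective.\<close>

lemma few_image_transfer:
  assumes "few k (j ` B)" and "h ` A \<subseteq> B"
    and inj: "\<And>x y. x \<in> A \<Longrightarrow> y \<in> A \<Longrightarrow> j (h x) = j (h y) \<Longrightarrow> i x = i y"
  shows "few k (i ` A)"
proof -
  have "(\<lambda>x. j (h x)) ` A \<subseteq> j ` B"
    using assms(2) by auto
  with assms(1) have C: "few k ((\<lambda>x. j (h x)) ` A)"
    by (rule few_subset)
  \<comment> \<open>\<open>g\<close> reads off \<open>i\<close> from any preimage of
    \<open>z\<close>; by \<open>inj\<close> the choice does not matter.\<close>
  define g where "g z = i (SOME x. x \<in> A \<and> j (h x) = z)" for z
  have g: "g (j (h x)) = i x" if "x \<in> A" for x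
  proof -
    define y where "y = (SOME y. y \<in> A \<and> j (h y) = j (h x))"
    have "y \<in> A \<and> j (h y) = j (h x)"
      unfolding y_def by (rule someI[of _ x]) (simp add: that)
    with inj[of y x] that show ?thesis
      by (simp add: g_def y_def)
  qed
  have "i ` A = g ` (\<lambda>x. j (h x)) ` A"
    unfolding image_image by (rule image_cong) (simp_all add: g)
  moreover have "few k (g ` B)" if "few k B" for B
    using that unfolding few_def by (metis finite_imageI imageE)
  ultimately show ?thesis
    using C by metis
qed

text \<open>The equivalence classes are the nonempty fibres of \<open>f\<close>. This turns the
  quotient in \<open>finite_factorization\<close> into a set of types.\<close>

lemma finite_quotient_kernel:
  "finite (A // {(x, y). x \<in> A \<and> y \<in> A \<and> f x = f y}) \<longleftrightarrow> finite (f ` A)"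
proof -
  let ?r = "{(x, y). x \<in> A \<and> y \<in> A \<and> f x = f y}"
  have "A // ?r = (\<lambda>z. {y \<in> A. f y = z}) ` f ` A"
  proof -
    have "?r `` {x} = {y \<in> A. f y = f x}" if "x \<in> A" for x
      using that by auto
    then have "A // ?r = (\<lambda>x. {y \<in> A. f y = f x}) ` A"
      unfolding quotient_def by blast
    then show ?thesis
      by (simp add: image_image)
  qed
  moreover have "inj_on (\<lambda>z. {y \<in> A. f y = z}) (f ` A)"
  proof (rule inj_onI)
    fix z z'
    assume "z \<in> f ` A" and eq: "{y \<in> A. f y = z} = {y \<in> A. f y = z'}"
    then obtain y where "y \<in> A" "f y = z"
      by blast
    then have "y \<in> {y \<in> A. f y = z}"
      by simp
    then show "z = z'"
      unfolding eq using \<open>f y = z\<close> by simp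
  qed
  ultimately show ?thesis
    by (simp add: finite_image_iff)
qed

text \<open>Replacing elements by their classes turns isomorphism of factorizations into an
  equality, which can be transported along maps.\<close>

definition sim_class :: "('a, 'm, 'd) module_scheme \<Rightarrow> 'a set \<Rightarrow> 'm \<Rightarrow> 'm set"
  where "sim_class M S m = {n \<in> carrier M. S_sim M S m n}"

abbreviation ring_class :: "('a, 'c) ring_scheme \<Rightarrow> 'a \<Rightarrow> 'a set"
  where "ring_class R \<equiv> sim_class (self_module R) (carrier R)"

text \<open>
  The isomorphism type of a factorization, cut down to its length if \<open>l\<close> is false. Unique and
  finite factorization count types for \<open>l = True\<close>, half factoriality counts types for \<open>l = False\<close>.
\<close>

definition fact_type ::
    "bool \<Rightarrow> ('a, 'c) ring_scheme \<Rightarrow> ('a, 'm, 'd) module_scheme \<Rightarrow> 'a set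
      \<Rightarrow> 'a list \<times> 'm \<Rightarrow> nat \<times> 'a set multiset \<times> 'm set"
  where "fact_type l R M S = (\<lambda>(ss, n). (length ss,
    if l then (mset (map (ring_class R) ss), sim_class M S n) else ({#}, {})))"

text \<open>\<open>(k, l)\<close> is \<open>(True, True)\<close> for unique,
  \<open>(False, True)\<close> for finite and \<open>(True, False)\<close> for half factorial. The
  set \<open>E\<close> is a parameter because the property is also needed for primitive elements
  alone.\<close>

definition few_types ::
    "bool \<Rightarrow> bool \<Rightarrow> ('a, 'c) ring_scheme \<Rightarrow> ('a, 'm, 'd) module_scheme \<Rightarrow> 'a set \<Rightarrow> 'm set \<Rightarrow> bool"
  where "few_types k l R M S E \<longleftrightarrow> (\<forall>m\<in>E. S_atomic_factorizations R M S m \<noteq> {} \<and>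
    few k (fact_type l R M S ` S_atomic_factorizations R M S m))"

section \<open>Isomorphism of factorizations as equality of types\<close>

context module_loc
begin

lemma S_sim_refl: "m \<in> carrier M \<Longrightarrow> S_sim M S m m"
  unfolding S_sim_def by (metis one_closed smult_one)

lemma S_sim_sym: "S_sim M S m n \<Longrightarrow> S_sim M S n m"
  unfolding S_sim_def by blast

lemma S_sim_trans:
  assumes "m \<in> carrier M" "n \<in> carrier M" "p \<in> carrier M" "S_sim M S m n" "S_sim M S n p"
  shows "S_sim M S m p"
proof -
  obtain s s' t t' where A: "s \<in> S" "s' \<in> S" "t \<in> S" "t' \<in> S"
      and eq: "m = s \<odot>\<^bsub>M\<^esub> n" "n = s' \<odot>\<^bsub>M\<^esub> m" "n = t \<odot>\<^bsub>M\<^esub> p" "p = t' \<odot>\<^bsub>M\<^esub> n"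
    using assms(4,5) unfolding S_sim_def by blast
  have "(s \<otimes> t) \<odot>\<^bsub>M\<^esub> p = m"
    using A assms(1-3) by (simp add: smult_assoc1 flip: eq(1,3))
  moreover have "(t' \<otimes> s') \<odot>\<^bsub>M\<^esub> m = p"
    using A assms(1-3) by (simp add: smult_assoc1 flip: eq(2,4))
  ultimately show ?thesis
    unfolding S_sim_def using A by (metis m_closed)
qed

lemma sim_class_eq_iff:
  assumes "m \<in> carrier M" "n \<in> carrier M"
  shows "sim_class M S m = sim_class M S n \<longleftrightarrow> S_sim M S m n"
proof
  assume eq: "sim_class M S m = sim_class M S n"
  have "n \<in> sim_class M S m"
    unfolding eq using assms by (simp add: sim_class_def S_sim_refl)
  then show "S_sim M S m n"
    by (simp add: sim_class_def)
next
  assume "S_sim M S m n"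
  then have "S_sim M S m p \<longleftrightarrow> S_sim M S n p" if "p \<in> carrier M" for p
    using S_sim_trans[of m n p] S_sim_trans[of n m p] S_sim_sym[of m n] assms that by blast
  then show "sim_class M S m = sim_class M S n"
    unfolding sim_class_def by (intro Collect_cong conj_cong refl)
qed

lemma module_loc_self_carrier: "module_loc R (self_module R) (carrier R)"
  by (simp add: module_loc_def module_self R.monoid_axioms submonoid_def R.one_closed)

lemma ring_class_eq_iff:
  "a \<in> carrier R \<Longrightarrow> b \<in> carrier R \<Longrightarrow> ring_class R a = ring_class R b \<longleftrightarrow> ring_sim R a b"
  using module_loc.sim_class_eq_iff[OF module_loc_self_carrier] by simp

text \<open>A permutation that matches two lists up to associates exists exactly when the lists of
  classes agree as multisets.\<close>

lemma isomorphic_iff_fact_type: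
  assumes "set ss \<subseteq> carrier R" "set ts \<subseteq> carrier R" "n \<in> carrier M" "n' \<in> carrier M"
  shows "isomorphic_factorizations R M S (ss, n) (ts, n') \<longleftrightarrow>
    fact_type True R M S (ss, n) = fact_type True R M S (ts, n')"
proof -
  let ?c = "ring_class R"
  have sim: "ring_sim R (ss ! i) (ts ! j) \<longleftrightarrow> ?c (ss ! i) = ?c (ts ! j)"
    if "i < length ss" "j < length ts" for i j
    using that assms(1,2) by (simp add: ring_class_eq_iff subset_iff)
  have perm: "(\<exists>\<sigma>. \<sigma> permutes {..<length ss} \<and> (\<forall>i<length ss. ring_sim R (ss ! i) (ts ! \<sigma> i)))
      \<longleftrightarrow> mset (map ?c ss) = mset (map ?c ts)" (is "?L \<longleftrightarrow> ?R")
    if len: "length ss = length ts"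
  proof
    assume ?L
    then obtain \<sigma> where p: "\<sigma> permutes {..<length ss}"
        and \<sigma>: "\<And>i. i < length ss \<Longrightarrow> ring_sim R (ss ! i) (ts ! \<sigma> i)"
      by blast
    have "\<sigma> i < length ts" if "i < length ss" for i
      using permutes_in_image[OF p, of i] that len by simp
    then have "map ?c ss = permute_list \<sigma> (map ?c ts)"
      using len p \<sigma> sim by (intro nth_equalityI) (auto simp: permute_list_nth)
    then show ?R
      using mset_permute_list[of \<sigma> "map ?c ts"] p len by (metis length_map)
  next
    assume ?R
    then obtain \<sigma> where p: "\<sigma> permutes {..<length (map ?c ts)}"
        and eq: "permute_list \<sigma> (map ?c ts) = map ?c ss"
      by (rule mset_eq_permutation)
    have "ring_sim R (ss ! i) (ts ! \<sigma> i)" if "i < length ss" for i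
    proof -
      have "\<sigma> i < length ts"
        using permutes_in_image[OF p, of i] that len by simp
      moreover have "permute_list \<sigma> (map ?c ts) ! i = ?c (ts ! \<sigma> i)"
        using p that len \<open>\<sigma> i < length ts\<close> by (simp add: permute_list_nth)
      ultimately show ?thesis
        using eq that sim by simp
    qed
    then show ?L
      using p len by (intro exI[of _ \<sigma>]) simp
  qed
  show ?thesis
  proof (cases "length ss = length ts")
    case True
    show ?thesis
      unfolding isomorphic_factorizations_def fact_type_def prod.case perm[OF True]
      using True assms(3,4) by (simp add: sim_class_eq_iff conj_commute)
  qed (simp add: isomorphic_factorizations_def fact_type_def)
qed

text \<open>A nested action peels off one factor at a time, which suits induction over the list
  better than the product of the scalars.\<close>

lemma S_factorizations_iff:
  "(ss, n) \<in> S_factorizations R M S m \<longleftrightarrow>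
    set ss \<subseteq> S - Units R \<and> n \<in> carrier M \<and> m = foldr (smult M) ss n"
proof -
  have "foldr (\<otimes>) ss \<one> \<odot>\<^bsub>M\<^esub> n = foldr (smult M) ss n"
    if "set ss \<subseteq> S - Units R" "n \<in> carrier M"
    using that(1)
  proof (induction ss)
    case Nil
    then show ?case using that(2) by simp
  next
    case (Cons s ss)
    then have "set ss \<subseteq> carrier R" "s \<in> carrier R"
      by auto
    then have "foldr (\<otimes>) ss \<one> \<in> carrier R"
      by (rule_tac R.multlist_closed)
    with Cons \<open>s \<in> carrier R\<close> that(2) show ?case
      by (simp add: smult_assoc1)
  qed
  then show ?thesis
    unfolding S_factorizations_def by auto
qed

lemma S_atomic_factorizations_iff:
  "(ss, n) \<in> S_atomic_factorizations R M S m \<longleftrightarrow>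
    set ss \<subseteq> S - Units R \<and> (\<forall>s\<in>set ss. irred R s) \<and> S_primitive M S n \<and> m = foldr (smult M) ss n"
  unfolding S_atomic_factorizations_def by (auto simp: S_factorizations_iff S_primitive_def)

lemma isomorphic_iff_fact_type':
  assumes "f \<in> S_atomic_factorizations R M S m" "g \<in> S_atomic_factorizations R M S m"
  shows "isomorphic_factorizations R M S f g \<longleftrightarrow> fact_type True R M S f = fact_type True R M S g"
proof -
  obtain ss n ts n' where "f = (ss, n)" "g = (ts, n')"
    by (cases f; cases g)
  with assms show ?thesis
    using isomorphic_iff_fact_type[of ss ts n n']
    by (auto simp: S_atomic_factorizations_iff S_primitive_def)
qed

lemma unique_factorization_iff:
  "unique_factorization R M S \<longleftrightarrow> few_types True True R M S (carrier M - {\<zero>\<^bsub>M\<^esub>})"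
proof -
  have "(\<forall>f\<in>S_atomic_factorizations R M S m. \<forall>g\<in>S_atomic_factorizations R M S m.
        isomorphic_factorizations R M S f g) \<longleftrightarrow>
      few True (fact_type True R M S ` S_atomic_factorizations R M S m)" for m
    unfolding few_True_image_iff by (intro ball_cong refl isomorphic_iff_fact_type')
  then show ?thesis
    unfolding unique_factorization_def few_types_def S_atomic_def ball_conj_distrib by (simp only:)
qed

lemma finite_factorization_iff:
  "finite_factorization R M S \<longleftrightarrow> few_types False True R M S (carrier M - {\<zero>\<^bsub>M\<^esub>})"
proof -
  have "{(f, g). f \<in> S_atomic_factorizations R M S m \<and> g \<in> S_atomic_factorizations R M S m \<and>
            isomorphic_factorizations R M S f g}
      = {(f, g). f \<in> S_atomic_factorizations R M S m \<and> g \<in> S_atomic_factorizations R M S m \<and>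
            fact_type True R M S f = fact_type True R M S g}" for m
    by (rule Collect_cong) (auto simp: isomorphic_iff_fact_type')
  then show ?thesis
    unfolding finite_factorization_def few_types_def S_atomic_def few_def ball_conj_distrib
    by (simp only: finite_quotient_kernel) blast
qed

lemma half_factorial_iff:
  "half_factorial R M S \<longleftrightarrow> few_types True False R M S (carrier M - {\<zero>\<^bsub>M\<^esub>})"
proof -
  have "few True (fact_type False R M S ` A) \<longleftrightarrow>
      (\<forall>(ss, n)\<in>A. \<forall>(ts, n')\<in>A. length ss = length ts)" for A
  proof -
    have "fact_type False R M S = (\<lambda>f. (length (fst f), {#}, {}))"
      by (simp add: fact_type_def case_prod_beta')
    then show ?thesis
      unfolding few_True_image_iff case_prod_beta' by (simp only: prod.inject simp_thms)
  qed
  then show ?thesis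
    unfolding half_factorial_def few_types_def S_atomic_def ball_conj_distrib by (simp only:)
qed

end

section \<open>Primitive elements\<close>

locale splitting_set = module_loc +
  assumes saturated: "saturated_mult R S"
    and regular_M: "S \<inter> zero_divisors R M (carrier M) = {}"
    and regular_R: "S \<inter> zero_divisors R (self_module R) (carrier R) = {}"
    and splits_M: "splits R M S (carrier M)"
begin

lemma smult_cancel:
  assumes "s \<in> S" "m \<in> carrier M" "n \<in> carrier M" "s \<odot>\<^bsub>M\<^esub> m = s \<odot>\<^bsub>M\<^esub> n"
  shows "m = n"
proof -
  have "s \<odot>\<^bsub>M\<^esub> (m \<ominus>\<^bsub>M\<^esub> n) = \<zero>\<^bsub>M\<^esub>"
    using assms by (simp add: M.minus_eq smult_r_distr smult_r_minus M.r_neg)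
  then have "m \<ominus>\<^bsub>M\<^esub> n = \<zero>\<^bsub>M\<^esub>"
    using regular_M assms(1-3) M.minus_closed[of m n] by (auto simp: zero_divisors_def)
  then show ?thesis
    using M.minus_equality[of m "\<ominus>\<^bsub>M\<^esub> n"] assms(2,3) by (simp add: M.minus_eq)
qed

lemma mult_cancel:
  assumes "s \<in> S" "a \<in> carrier R" "b \<in> carrier R" "s \<otimes> a = s \<otimes> b"
  shows "a = b"
proof -
  have "s \<otimes> (a \<ominus> b) = \<zero>"
    using assms by (simp add: R.minus_eq R.r_distr R.r_minus R.r_neg)
  then have "a \<ominus> b = \<zero>"
    using regular_R assms(1-3) R.minus_closed[of a b] S_R[OF assms(1)]
    unfolding zero_divisors_def self_module_simps by blast
  then show ?thesis
    using assms(2,3) by simp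
qed

lemma saturatedD: "a \<otimes> b \<in> S \<Longrightarrow> a \<in> carrier R \<Longrightarrow> b \<in> carrier R \<Longrightarrow> a \<in> S \<and> b \<in> S"
  using saturated unfolding saturated_mult_def by blast

lemma Units_subset: "Units R \<subseteq> S"
proof
  fix e assume "e \<in> Units R"
  then show "e \<in> S"
    by (intro saturatedD[THEN conjunct1, of e "inv e"]) (simp_all add: R.Units_closed)
qed

lemma UnitsI:
  assumes "a \<otimes> b = \<one>" "a \<in> carrier R" "b \<in> carrier R"
  shows "a \<in> Units R"
proof -
  have "b \<otimes> a = \<one>"
    unfolding R.m_comm[OF assms(3,2)] by (rule assms(1))
  then show ?thesis
    unfolding Units_def using assms by blast
qed

lemma Units_factor: "a \<otimes> b \<in> Units R \<Longrightarrow> a \<in> carrier R \<Longrightarrow> b \<in> carrier R \<Longrightarrow> a \<in> Units R"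
  by (rule R.unit_factor)

lemma smult_inv: "e \<in> Units R \<Longrightarrow> m \<in> carrier M \<Longrightarrow> inv e \<odot>\<^bsub>M\<^esub> (e \<odot>\<^bsub>M\<^esub> m) = m"
  by (simp add: R.Units_closed flip: smult_assoc1)

text \<open>Associates in a ring with zero divisors need not differ by a unit. Here
  \<open>s = s (a b)\<close>, and the regular element \<open>s\<close> cancels.\<close>

lemma ring_sim_S:
  assumes "s \<in> S" "t \<in> S" "ring_sim R s t"
  shows "\<exists>e\<in>Units R. s = e \<otimes> t"
proof -
  obtain a b where ab: "a \<in> carrier R" "b \<in> carrier R" and s: "s = a \<otimes> t" and t: "t = b \<otimes> s"
    using assms(3) unfolding S_sim_def self_module_simps by blast
  have "s \<otimes> (a \<otimes> b) = a \<otimes> (b \<otimes> s)"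
    using ab assms(1,2) by (simp add: R.m_ac)
  also have "\<dots> = s \<otimes> \<one>"
    using assms(1) by (simp flip: s t)
  finally have "a \<otimes> b = \<one>"
    using assms(1) ab by (rule_tac mult_cancel) auto
  then show ?thesis
    using s ab UnitsI by blast
qed

lemma semi_factorable: "semi_factorable R M S (carrier M)"
  using splits_M unfolding splits_def by blast

lemma compact_factorizationE:
  assumes "m \<in> carrier M" "m \<noteq> \<zero>\<^bsub>M\<^esub>"
  obtains s p where "s \<in> S" "S_primitive M S p" "m = s \<odot>\<^bsub>M\<^esub> p"
  using semi_factorable assms
  unfolding semi_factorable_def compactly_atomic_def compact_atomic_factorizations_def by blast

lemma compact_factorization_scalar_unique:
  assumes "s \<in> S" "t \<in> S" "S_primitive M S p" "S_primitive M S q"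
    and "s \<odot>\<^bsub>M\<^esub> p = t \<odot>\<^bsub>M\<^esub> q" "s \<odot>\<^bsub>M\<^esub> p \<noteq> \<zero>\<^bsub>M\<^esub>"
  shows "\<exists>e\<in>Units R. s = e \<otimes> t"
proof -
  have "(s, p) \<in> compact_atomic_factorizations M S (s \<odot>\<^bsub>M\<^esub> p)"
    and "(t, q) \<in> compact_atomic_factorizations M S (s \<odot>\<^bsub>M\<^esub> p)"
    and "s \<odot>\<^bsub>M\<^esub> p \<in> carrier M - {\<zero>\<^bsub>M\<^esub>}"
    using assms by (auto simp: compact_atomic_factorizations_def S_primitive_def)
  then have "ring_sim R s t"
    using semi_factorable unfolding semi_factorable_def by fast
  then show ?thesis
    using assms(1,2) by (rule_tac ring_sim_S)
qed

text \<open>If \<open>m = t p\<close> with \<open>p\<close> primitive, then \<open>t p\<close> and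
  \<open>(s t) p\<close> are two compact factorizations of \<open>m\<close>; semi-factorability
  gives \<open>s t = e t\<close> with a unit \<open>e\<close>, and \<open>t\<close> cancels.\<close>

lemma S_presimplifiable:
  assumes "s \<in> S" "m \<in> carrier M" "m \<noteq> \<zero>\<^bsub>M\<^esub>" "s \<odot>\<^bsub>M\<^esub> m = m"
  shows "s \<in> Units R"
proof -
  obtain t p where t: "t \<in> S" "S_primitive M S p" "m = t \<odot>\<^bsub>M\<^esub> p"
    using compact_factorizationE assms by blast
  then have p: "p \<in> carrier M"
    by (simp add: S_primitive_def)
  then have "(s \<otimes> t) \<odot>\<^bsub>M\<^esub> p = s \<odot>\<^bsub>M\<^esub> m"
    using t assms(1) by (simp add: smult_assoc1)
  then have "(s \<otimes> t) \<odot>\<^bsub>M\<^esub> p = t \<odot>\<^bsub>M\<^esub> p"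
    using assms(4) t(3) by simp
  moreover have "(s \<otimes> t) \<odot>\<^bsub>M\<^esub> p \<noteq> \<zero>\<^bsub>M\<^esub>"
    using calculation assms(3) t(3) by simp
  ultimately obtain e where e: "e \<in> Units R" and eq: "s \<otimes> t = e \<otimes> t"
    using compact_factorization_scalar_unique[of "s \<otimes> t" t p p] assms(1) t by auto
  have "t \<otimes> s = t \<otimes> e"
    using eq assms(1) t(1) e by (simp add: R.m_comm R.Units_closed)
  then have "s = e"
    using assms(1) t(1) e by (rule_tac mult_cancel) (auto simp: R.Units_closed)
  then show ?thesis
    using e by simp
qed

text \<open>For nonzero \<open>m\<close> this agrees with \<open>S_primitive\<close> (see
  \<open>S_primitive_iff_mprim\<close>) but speaks of units instead of \<open>S_sim\<close>. Zero,
  which is always \<open>S_primitive\<close> here because elements of \<open>S\<close> act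
  injectively, is left out.\<close>

definition mprim :: "'c \<Rightarrow> bool"
  where "mprim m \<longleftrightarrow> m \<in> carrier M \<and> m \<noteq> \<zero>\<^bsub>M\<^esub> \<and>
    (\<forall>s\<in>S. \<forall>n\<in>carrier M. m = s \<odot>\<^bsub>M\<^esub> n \<longrightarrow> s \<in> Units R)"

lemma mprimD:
  assumes "mprim m"
  shows "m \<in> carrier M" "m \<noteq> \<zero>\<^bsub>M\<^esub>"
    "m = s \<odot>\<^bsub>M\<^esub> n \<Longrightarrow> s \<in> S \<Longrightarrow> n \<in> carrier M \<Longrightarrow> s \<in> Units R"
  using assms unfolding mprim_def by blast+

text \<open>If \<open>m = s n\<close> and \<open>n = t m\<close>, then \<open>s t\<close> fixes
  \<open>m\<close> and is a unit by \<open>S_presimplifiable\<close>, hence so is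
  \<open>s\<close>.\<close>

lemma S_primitive_iff_mprim:
  assumes "m \<noteq> \<zero>\<^bsub>M\<^esub>"
  shows "S_primitive M S m \<longleftrightarrow> mprim m"
proof
  assume prim: "S_primitive M S m"
  then have m: "m \<in> carrier M"
    by (simp add: S_primitive_def)
  have "s \<in> Units R" if s: "s \<in> S" and n: "n \<in> carrier M" and eq: "m = s \<odot>\<^bsub>M\<^esub> n" for s n
  proof -
    obtain t where t: "t \<in> S" "n = t \<odot>\<^bsub>M\<^esub> m"
      using prim s n eq unfolding S_primitive_def S_sim_def by blast
    then have "(s \<otimes> t) \<odot>\<^bsub>M\<^esub> m = m"
      using s m by (simp add: smult_assoc1 flip: t(2) eq)
    then have "s \<otimes> t \<in> Units R"
      using s t m assms by (rule_tac S_presimplifiable) auto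
    then show ?thesis
      using s t Units_factor by blast
  qed
  then show "mprim m"
    unfolding mprim_def using m assms by blast
next
  assume m: "mprim m"
  have "S_sim M S n m" if s: "s \<in> S" and n: "n \<in> carrier M" and eq: "m = s \<odot>\<^bsub>M\<^esub> n" for s n
  proof -
    have "s \<in> Units R"
      using mprimD(3)[OF m eq] s n by simp
    moreover from this have "n = inv s \<odot>\<^bsub>M\<^esub> m"
      unfolding eq using n by (simp add: smult_inv)
    moreover have "inv s \<in> S"
      using calculation(1) Units_subset by blast
    ultimately show ?thesis
      unfolding S_sim_def using s eq by blast
  qed
  then show "S_primitive M S m"
    unfolding S_primitive_def using mprimD(1)[OF m] by blast
qed

lemma mprim_factorizationE:
  assumes "m \<in> carrier M" "m \<noteq> \<zero>\<^bsub>M\<^esub>"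
  obtains s p where "s \<in> S" "mprim p" "m = s \<odot>\<^bsub>M\<^esub> p"
proof -
  obtain s p where "s \<in> S" "S_primitive M S p" "m = s \<odot>\<^bsub>M\<^esub> p"
    using compact_factorizationE assms by blast
  moreover have "p \<noteq> \<zero>\<^bsub>M\<^esub>"
    using calculation assms by auto
  ultimately show ?thesis
    using S_primitive_iff_mprim that by blast
qed

lemma smult_nonzero:
  assumes "s \<in> S" "m \<in> carrier M" "m \<noteq> \<zero>\<^bsub>M\<^esub>"
  shows "s \<odot>\<^bsub>M\<^esub> m \<noteq> \<zero>\<^bsub>M\<^esub>"
  using smult_cancel[of s m "\<zero>\<^bsub>M\<^esub>"] assms by auto

text \<open>Semi-factorability compares the scalars only; cancelling \<open>t\<close> carries the
  unit over to the primitive parts.\<close>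

lemma mprim_factorization_unique:
  assumes "s \<in> S" "t \<in> S" "mprim p" "mprim q" "s \<odot>\<^bsub>M\<^esub> p = t \<odot>\<^bsub>M\<^esub> q"
  shows "\<exists>e\<in>Units R. s = e \<otimes> t \<and> q = e \<odot>\<^bsub>M\<^esub> p"
proof -
  have pq: "p \<in> carrier M" "q \<in> carrier M" "p \<noteq> \<zero>\<^bsub>M\<^esub>" "q \<noteq> \<zero>\<^bsub>M\<^esub>"
    using assms mprimD by blast+
  then obtain e where e: "e \<in> Units R" "s = e \<otimes> t"
    using compact_factorization_scalar_unique[of s t p q] assms S_primitive_iff_mprim smult_nonzero
    by blast
  have "t \<odot>\<^bsub>M\<^esub> (e \<odot>\<^bsub>M\<^esub> p) = t \<odot>\<^bsub>M\<^esub> q"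
    using assms(2,5) e pq by (simp add: R.Units_closed R.m_comm[of t e] flip: smult_assoc1)
  then have "e \<odot>\<^bsub>M\<^esub> p = q"
    using assms(2) pq e by (rule_tac smult_cancel) (auto simp: R.Units_closed)
  then show ?thesis
    using e by blast
qed

text \<open>Every scalar in a factorization of a nonzero element of \<open>M\<close> belongs to this
  set. About the annihilator the module gives no information.\<close>

definition live :: "'a set"
  where "live = carrier R - annihilator R M (carrier M)"

lemma live_iff: "a \<in> live \<longleftrightarrow> a \<in> carrier R \<and> (\<exists>m\<in>carrier M. a \<odot>\<^bsub>M\<^esub> m \<noteq> \<zero>\<^bsub>M\<^esub>)"
  by (auto simp: live_def annihilator_def)

text \<open>Write \<open>m = s p\<close> with \<open>p\<close> primitive: if \<open>a p\<close>
  vanished, so would \<open>a m = s (a p)\<close>.\<close>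

lemma live_mprimE:
  assumes "a \<in> live"
  obtains p where "mprim p" "a \<odot>\<^bsub>M\<^esub> p \<noteq> \<zero>\<^bsub>M\<^esub>"
proof -
  obtain m where m: "a \<in> carrier R" "m \<in> carrier M" "a \<odot>\<^bsub>M\<^esub> m \<noteq> \<zero>\<^bsub>M\<^esub>"
    using assms by (auto simp: live_iff)
  then have "m \<noteq> \<zero>\<^bsub>M\<^esub>"
    by auto
  then obtain s p where s: "s \<in> S" "mprim p" "m = s \<odot>\<^bsub>M\<^esub> p"
    using m mprim_factorizationE by blast
  have "s \<odot>\<^bsub>M\<^esub> (a \<odot>\<^bsub>M\<^esub> p) \<noteq> \<zero>\<^bsub>M\<^esub>"
    using m(1,3) s mprimD(1)[OF s(2)] by (simp add: smult_swap[of s a p])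
  then have "a \<odot>\<^bsub>M\<^esub> p \<noteq> \<zero>\<^bsub>M\<^esub>"
    using s(1) by auto
  then show ?thesis
    using that s by blast
qed

lemma live_factor:
  assumes "a \<otimes> b \<in> live" "a \<in> carrier R" "b \<in> carrier R"
  shows "a \<in> live" "b \<in> live"
proof -
  obtain m where m: "m \<in> carrier M" "(a \<otimes> b) \<odot>\<^bsub>M\<^esub> m \<noteq> \<zero>\<^bsub>M\<^esub>"
    using assms(1) by (auto simp: live_iff)
  then have *: "a \<odot>\<^bsub>M\<^esub> (b \<odot>\<^bsub>M\<^esub> m) \<noteq> \<zero>\<^bsub>M\<^esub>" "b \<odot>\<^bsub>M\<^esub> m \<in> carrier M"
    using assms by (auto simp: smult_assoc1)
  then show "a \<in> live"
    using assms by (auto simp: live_iff)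
  have "b \<odot>\<^bsub>M\<^esub> m \<noteq> \<zero>\<^bsub>M\<^esub>"
    using * assms by auto
  then show "b \<in> live"
    using assms m by (auto simp: live_iff)
qed

text \<open>The counterpart of \<open>mprim\<close> for scalars, where \<open>live\<close> replaces
  nonzero: units are recognized by \<open>S_presimplifiable\<close>, that is through the action on
  \<open>M\<close>. For live scalars it agrees with \<open>S_primitive\<close> over
  \<open>self_module R\<close>.\<close>

definition rprim :: "'a \<Rightarrow> bool"
  where "rprim a \<longleftrightarrow> a \<in> live \<and> (\<forall>s\<in>S. \<forall>b\<in>carrier R. a = s \<otimes> b \<longrightarrow> s \<in> Units R)"

lemma rprimD:
  assumes "rprim a"
  shows "a \<in> live" "a \<in> carrier R"
    "a = s \<otimes> b \<Longrightarrow> s \<in> S \<Longrightarrow> b \<in> carrier R \<Longrightarrow> s \<in> Units R"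
  using assms unfolding rprim_def live_def by blast+

lemma rprim_in_S: "rprim a \<Longrightarrow> a \<in> S \<Longrightarrow> a \<in> Units R"
  using rprimD(3)[of a a \<one>] by simp

lemma rprim_imp_S_primitive:
  assumes a: "rprim a"
  shows "S_primitive (self_module R) S a"
proof -
  have "S_sim (self_module R) S b a" if s: "s \<in> S" and b: "b \<in> carrier R" and eq: "a = s \<otimes> b" for s b
  proof -
    have "s \<in> Units R"
      using rprimD(3)[OF a eq] s b by simp
    moreover from this have "b = inv s \<otimes> a"
      unfolding eq using b by (simp add: R.Units_closed flip: R.m_assoc)
    moreover have "inv s \<in> S"
      using calculation(1) Units_subset by blast
    ultimately show ?thesis
      unfolding S_sim_def self_module_simps using s eq by blast
  qed
  then show ?thesis
    unfolding S_primitive_def using rprimD(2)[OF a] by simp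
qed

lemma S_primitive_imp_rprim:
  assumes prim: "S_primitive (self_module R) S a" and a: "a \<in> live"
  shows "rprim a"
proof -
  obtain m where m: "m \<in> carrier M" "a \<odot>\<^bsub>M\<^esub> m \<noteq> \<zero>\<^bsub>M\<^esub>" and aR: "a \<in> carrier R"
    using a by (auto simp: live_iff)
  have "s \<in> Units R" if s: "s \<in> S" and b: "b \<in> carrier R" and eq: "a = s \<otimes> b" for s b
  proof -
    have "S_sim (self_module R) S b a"
      using prim s b eq unfolding S_primitive_def by simp
    then obtain t where t: "t \<in> S" "b = t \<otimes> a"
      unfolding S_sim_def self_module_simps by blast
    then have "(s \<otimes> t) \<odot>\<^bsub>M\<^esub> (a \<odot>\<^bsub>M\<^esub> m) = a \<odot>\<^bsub>M\<^esub> m"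
      using s m aR by (simp add: R.m_assoc flip: smult_assoc1 t(2) eq)
    then have "s \<otimes> t \<in> Units R"
      using s t m aR by (rule_tac S_presimplifiable) auto
    then show ?thesis
      using s t Units_factor by blast
  qed
  then show "rprim a"
    unfolding rprim_def using a by blast
qed

text \<open>The only appeal to the second condition of \<open>splits\<close>; all closure of
  primitive elements under products rests on it.\<close>

lemma mprim_smult:
  assumes "rprim a" "mprim m" "a \<odot>\<^bsub>M\<^esub> m \<noteq> \<zero>\<^bsub>M\<^esub>"
  shows "mprim (a \<odot>\<^bsub>M\<^esub> m)"
proof -
  have "a \<odot>\<^bsub>M\<^esub> m \<in> carrier M"
    using assms rprimD mprimD by simp
  moreover have "S_primitive M S m"
    using assms S_primitive_iff_mprim mprimD by blast
  ultimately have "S_primitive M S (a \<odot>\<^bsub>M\<^esub> m)"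
    using splits_M rprim_imp_S_primitive assms unfolding splits_def by blast
  then show ?thesis
    using S_primitive_iff_mprim assms by blast
qed

text \<open>Splitting says nothing about products of two scalars, so they act on a primitive
  \<open>p\<close> not killed by \<open>a b\<close>: the element \<open>a (b p)\<close> is
  primitive, and a divisor of \<open>a b\<close> in \<open>S\<close> divides it.\<close>

lemma rprim_mult:
  assumes "rprim a" "rprim b" "a \<otimes> b \<in> live"
  shows "rprim (a \<otimes> b)"
proof -
  have ab: "a \<in> carrier R" "b \<in> carrier R"
    using assms rprimD by blast+
  obtain p where p: "mprim p" "(a \<otimes> b) \<odot>\<^bsub>M\<^esub> p \<noteq> \<zero>\<^bsub>M\<^esub>"
    using assms(3) by (rule live_mprimE)
  have pc: "p \<in> carrier M"
    using p mprimD by blast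
  have nz: "a \<odot>\<^bsub>M\<^esub> (b \<odot>\<^bsub>M\<^esub> p) \<noteq> \<zero>\<^bsub>M\<^esub>"
    using p pc ab by (simp add: smult_assoc1)
  then have "b \<odot>\<^bsub>M\<^esub> p \<noteq> \<zero>\<^bsub>M\<^esub>"
    using ab by auto
  then have prim: "mprim (a \<odot>\<^bsub>M\<^esub> (b \<odot>\<^bsub>M\<^esub> p))"
    using assms p nz mprim_smult by blast
  have "s \<in> Units R" if s: "s \<in> S" and x: "x \<in> carrier R" and eq: "a \<otimes> b = s \<otimes> x" for s x
  proof -
    have "a \<odot>\<^bsub>M\<^esub> (b \<odot>\<^bsub>M\<^esub> p) = s \<odot>\<^bsub>M\<^esub> (x \<odot>\<^bsub>M\<^esub> p)"
      using s x pc ab by (simp add: eq flip: smult_assoc1)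
    then show ?thesis
      using mprimD(3)[OF prim] s x pc by simp
  qed
  then show ?thesis
    unfolding rprim_def using assms by blast
qed

text \<open>Acting on a primitive \<open>p\<close> with \<open>a p\<close> nonzero turns both sides
  into compact factorizations in \<open>M\<close>, whose uniqueness yields \<open>e\<close>.
  Regularity of \<open>t\<close> in \<open>R\<close> then gives \<open>b = e a\<close>.\<close>

lemma rprim_cancel:
  assumes "s \<in> S" "t \<in> S" "rprim a" "rprim b" "s \<otimes> a = t \<otimes> b"
  shows "\<exists>e\<in>Units R. s = e \<otimes> t \<and> b = e \<otimes> a"
proof -
  have ab: "a \<in> carrier R" "b \<in> carrier R"
    using assms rprimD by blast+
  obtain p where p: "mprim p" "a \<odot>\<^bsub>M\<^esub> p \<noteq> \<zero>\<^bsub>M\<^esub>"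
    using live_mprimE rprimD(1) assms(3) by blast
  have pc: "p \<in> carrier M"
    using p mprimD by blast
  have eq: "s \<odot>\<^bsub>M\<^esub> (a \<odot>\<^bsub>M\<^esub> p) = t \<odot>\<^bsub>M\<^esub> (b \<odot>\<^bsub>M\<^esub> p)"
    using assms(1,2,5) pc ab by (simp flip: smult_assoc1)
  then have "t \<odot>\<^bsub>M\<^esub> (b \<odot>\<^bsub>M\<^esub> p) \<noteq> \<zero>\<^bsub>M\<^esub>"
    using smult_nonzero[OF assms(1) _ p(2)] ab pc by simp
  then have "b \<odot>\<^bsub>M\<^esub> p \<noteq> \<zero>\<^bsub>M\<^esub>"
    using assms(2) by auto
  then obtain e where e: "e \<in> Units R" "s = e \<otimes> t"
    using mprim_factorization_unique[OF assms(1,2) _ _ eq] mprim_smult assms p by blast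
  have "t \<otimes> (e \<otimes> a) = t \<otimes> b"
    using assms(2,5) e ab by (simp add: R.Units_closed R.m_ac)
  then have "e \<otimes> a = b"
    using assms(2) ab e by (rule_tac mult_cancel) (auto simp: R.Units_closed)
  then show ?thesis
    using e by blast
qed

text \<open>
  If \<open>a = s b\<close> with \<open>s \<in> S\<close> then \<open>a \<sim> b\<close>, because \<open>a \<sim> s\<close> would put \<open>a\<close> into \<open>S\<close>. So \<open>b = c a\<close>, and
  on a primitive \<open>p\<close> with \<open>a p = t q\<close>, \<open>q\<close> primitive, this gives \<open>q = s (c q)\<close>.
\<close>

lemma irred_imp_rprim:
  assumes a: "irred R a" "a \<in> live" "a \<notin> S"
  shows "rprim a"
proof -
  have aR: "a \<in> carrier R"
    using a(2) by (simp add: live_iff)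
  have "s \<in> Units R" if s: "s \<in> S" and b: "b \<in> carrier R" and eq: "a = s \<otimes> b" for s b
  proof -
    have "\<not> ring_sim R a s"
    proof
      assume "ring_sim R a s"
      then obtain x where "x \<in> carrier R" and "s = x \<otimes> a"
        unfolding S_sim_def self_module_simps by blast
      with s have "x \<otimes> a \<in> S"
        by simp
      then show False
        using saturatedD[of x a] \<open>x \<in> carrier R\<close> aR a(3) by blast
    qed
    then have "ring_sim R a b"
      using a(1) s b eq unfolding irred_def by blast
    then obtain c where c: "c \<in> carrier R" "b = c \<otimes> a"
      unfolding S_sim_def self_module_simps by blast
    obtain m where m: "m \<in> carrier M" "a \<odot>\<^bsub>M\<^esub> m \<noteq> \<zero>\<^bsub>M\<^esub>"
      using a(2) by (auto simp: live_iff)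
    then obtain t q where t: "t \<in> S" "mprim q" "a \<odot>\<^bsub>M\<^esub> m = t \<odot>\<^bsub>M\<^esub> q"
      using mprim_factorizationE[of "a \<odot>\<^bsub>M\<^esub> m"] aR by blast
    have q: "q \<in> carrier M"
      using t mprimD by blast
    have "t \<odot>\<^bsub>M\<^esub> (s \<odot>\<^bsub>M\<^esub> (c \<odot>\<^bsub>M\<^esub> q)) = s \<odot>\<^bsub>M\<^esub> (c \<odot>\<^bsub>M\<^esub> (a \<odot>\<^bsub>M\<^esub> m))"
      using t(1) s c(1) q by (simp add: t(3) smult_swap[of t])
    also have "\<dots> = (s \<otimes> (c \<otimes> a)) \<odot>\<^bsub>M\<^esub> m"
      using s c(1) aR m(1) by (simp add: smult_assoc1)
    also have "\<dots> = t \<odot>\<^bsub>M\<^esub> q"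
      by (simp flip: c(2) eq t(3))
    finally have "s \<odot>\<^bsub>M\<^esub> (c \<odot>\<^bsub>M\<^esub> q) = q"
      using t(1) s c(1) q by (rule_tac smult_cancel) auto
    then show ?thesis
      using mprimD(3)[OF t(2), of s "c \<odot>\<^bsub>M\<^esub> q"] s c(1) q by simp
  qed
  then show ?thesis
    unfolding rprim_def using a(2) by blast
qed

end

section \<open>Products acting on a module\<close>

context module
begin

lemma foldr_smult_closed [simp]:
  "set ss \<subseteq> carrier R \<Longrightarrow> n \<in> carrier M \<Longrightarrow> foldr (smult M) ss n \<in> carrier M"
  by (induction ss) auto

lemma foldr_smult_zero [simp]:
  "set ss \<subseteq> carrier R \<Longrightarrow> foldr (smult M) ss \<zero>\<^bsub>M\<^esub> = \<zero>\<^bsub>M\<^esub>"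
  by (induction ss) auto

lemma foldr_smult_smult:
  assumes "set ss \<subseteq> carrier R" "a \<in> carrier R" "n \<in> carrier M"
  shows "foldr (smult M) ss (a \<odot>\<^bsub>M\<^esub> n) = a \<odot>\<^bsub>M\<^esub> foldr (smult M) ss n"
  using assms(1)
proof (induction ss)
  case (Cons s ss)
  then show ?case
    using assms(2,3) by (simp add: R.m_comm[of s a] flip: smult_assoc1)
qed simp

lemma foldr_smult_partition:
  assumes "set ss \<subseteq> carrier R" "n \<in> carrier M"
  shows "foldr (smult M) ss n
    = foldr (smult M) (filter P ss) (foldr (smult M) (filter (\<lambda>s. \<not> P s) ss) n)"
  using assms(1)
proof (induction ss)
  case (Cons s ss)
  have "set (filter P ss) \<subseteq> carrier R" "set (filter (\<lambda>s. \<not> P s) ss) \<subseteq> carrier R"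
    using Cons.prems by auto
  with Cons assms(2) show ?case
    by (simp add: foldr_smult_smult)
qed simp

lemma foldr_smult_scalar:
  assumes "submonoid A R" "set ss \<subseteq> A"
  shows "\<exists>a\<in>A. \<forall>n\<in>carrier M. foldr (smult M) ss n = a \<odot>\<^bsub>M\<^esub> n"
  using assms(2)
proof (induction ss)
  case Nil
  then show ?case
    using submonoid.one_closed[OF assms(1)] by (auto intro!: bexI[of _ \<one>])
next
  case (Cons s ss)
  then obtain a where a: "a \<in> A" "\<And>n. n \<in> carrier M \<Longrightarrow> foldr (smult M) ss n = a \<odot>\<^bsub>M\<^esub> n"
    by auto
  have "s \<in> carrier R" "a \<in> carrier R" "s \<otimes> a \<in> A"
    using Cons.prems a submonoid.subset[OF assms(1)] submonoid.m_closed[OF assms(1)] by auto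
  then show ?case
    using a by (auto intro!: bexI[of _ "s \<otimes> a"] simp: smult_assoc1)
qed

end

text \<open>Placed outside \<open>splitting_set\<close> so that it applies to \<open>S'\<close> too,
  for which no splitting is assumed.\<close>

lemma (in module_loc) S_primitive_unit_smult:
  assumes "Units R \<subseteq> S" "e \<in> Units R" and n: "S_primitive M S n"
  shows "S_primitive M S (e \<odot>\<^bsub>M\<^esub> n)" "S_sim M S n (e \<odot>\<^bsub>M\<^esub> n)"
proof -
  have e: "e \<in> S" "inv e \<in> S" "e \<in> carrier R" "inv e \<in> carrier R"
    using assms(1,2) by auto
  have nc: "n \<in> carrier M"
    using n by (simp add: S_primitive_def)
  have inv: "inv e \<odot>\<^bsub>M\<^esub> (e \<odot>\<^bsub>M\<^esub> m) = m" if "m \<in> carrier M" for m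
    using assms(2) e(3,4) that by (simp flip: smult_assoc1)
  show sim: "S_sim M S n (e \<odot>\<^bsub>M\<^esub> n)"
    unfolding S_sim_def using e nc by (metis inv)
  have "S_sim M S x (e \<odot>\<^bsub>M\<^esub> n)"
    if s: "s \<in> S" and x: "x \<in> carrier M" and eq: "e \<odot>\<^bsub>M\<^esub> n = s \<odot>\<^bsub>M\<^esub> x" for s x
  proof -
    have "n = (inv e \<otimes> s) \<odot>\<^bsub>M\<^esub> x"
      using e s x inv[OF nc] by (simp add: eq smult_assoc1)
    then have "S_sim M S x n"
      using n e s x unfolding S_primitive_def by blast
    then show ?thesis
      using sim S_sim_trans e nc x by blast
  qed
  then show "S_primitive M S (e \<odot>\<^bsub>M\<^esub> n)"
    unfolding S_primitive_def using e(3) nc by simp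
qed

section \<open>Refinement of factorizations, length bounds and primitive parts of scalars\<close>

context splitting_set
begin

lemma mprim_foldr_smult:
  assumes "mprim n" "\<forall>s\<in>set ss. rprim s" "foldr (smult M) ss n \<noteq> \<zero>\<^bsub>M\<^esub>"
  shows "mprim (foldr (smult M) ss n)"
  using assms(2,3)
proof (induction ss)
  case (Cons s ss)
  have "s \<in> carrier R"
    using Cons.prems rprimD(2) by simp
  then have "foldr (smult M) ss n \<noteq> \<zero>\<^bsub>M\<^esub>"
    using Cons.prems by auto
  then show ?case
    using Cons mprim_smult by simp
qed (simp add: assms(1))

lemma mprim_smultD:
  assumes "mprim (a \<odot>\<^bsub>M\<^esub> m)" "a \<in> carrier R" "m \<in> carrier M"
  shows "rprim a" "mprim m"
proof -
  note p = mprimD[OF assms(1)]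
  have "a \<in> live"
    using assms p(2) by (auto simp: live_iff)
  moreover have "s \<in> Units R" if "s \<in> S" "b \<in> carrier R" "a = s \<otimes> b" for s b
    using that assms p(3)[of s "b \<odot>\<^bsub>M\<^esub> m"] by (simp add: smult_assoc1)
  ultimately show "rprim a"
    unfolding rprim_def by blast
  have "m \<noteq> \<zero>\<^bsub>M\<^esub>"
    using p(2) assms by auto
  moreover have "s \<in> Units R" if "s \<in> S" "n \<in> carrier M" "m = s \<odot>\<^bsub>M\<^esub> n" for s n
    using that assms p(3)[of s "a \<odot>\<^bsub>M\<^esub> n"] by (simp add: smult_swap[of s a n])
  ultimately show "mprim m"
    unfolding mprim_def using assms(3) by blast
qed

lemma mprim_foldr_smultD:
  assumes "mprim (foldr (smult M) ss n)" "set ss \<subseteq> carrier R" "n \<in> carrier M"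
  shows "(\<forall>s\<in>set ss. rprim s) \<and> mprim n"
  using assms(1,2)
proof (induction ss)
  case (Cons s ss)
  have "rprim s" "mprim (foldr (smult M) ss n)"
    using mprim_smultD[of s "foldr (smult M) ss n"] Cons.prems assms(3) by simp_all
  then show ?case
    using Cons by simp
qed simp

lemma foldr_smult_live:
  assumes "set ss \<subseteq> carrier R" "n \<in> carrier M" "foldr (smult M) ss n \<noteq> \<zero>\<^bsub>M\<^esub>"
  shows "set ss \<subseteq> live"
  using assms(1,3)
proof (induction ss)
  case (Cons s ss)
  then have "s \<odot>\<^bsub>M\<^esub> foldr (smult M) ss n \<noteq> \<zero>\<^bsub>M\<^esub>" "foldr (smult M) ss n \<in> carrier M" "s \<in> carrier R"
    using assms(2) by simp_all
  then have "s \<in> live" "foldr (smult M) ss n \<noteq> \<zero>\<^bsub>M\<^esub>"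
    by (auto simp: live_iff)
  then show ?case
    using Cons by simp
qed simp

lemma S_atomic_factorization_mprim:
  assumes "(ts, q) \<in> S_atomic_factorizations R M S m" "m \<noteq> \<zero>\<^bsub>M\<^esub>"
  shows "mprim q" "set ts \<subseteq> S - Units R" "m = foldr (smult M) ts q"
proof -
  have A: "set ts \<subseteq> S - Units R" "S_primitive M S q" "m = foldr (smult M) ts q"
    using assms(1) by (simp_all add: S_atomic_factorizations_iff)
  then have "set ts \<subseteq> carrier R"
    by auto
  then have "q \<noteq> \<zero>\<^bsub>M\<^esub>"
    using A(3) assms(2) by auto
  then show "mprim q" "set ts \<subseteq> S - Units R" "m = foldr (smult M) ts q"
    using A S_primitive_iff_mprim by blast+
qed

text \<open>Atomicity concerns elements of \<open>M\<close>, so the nonunits \<open>s\<close> cannot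
  be refined separately. Instead each \<open>s\<close> is pushed onto the primitive end
  \<open>q\<close> of the factorization built so far, and \<open>s q\<close> is factored
  again.\<close>

lemma S_factorization_refine:
  assumes atomic: "\<forall>m\<in>carrier M - {\<zero>\<^bsub>M\<^esub>}. S_atomic_factorizations R M S m \<noteq> {}"
    and "set ss \<subseteq> S - Units R" "n \<in> carrier M" "foldr (smult M) ss n \<noteq> \<zero>\<^bsub>M\<^esub>"
  shows "\<exists>(ts, q) \<in> S_atomic_factorizations R M S (foldr (smult M) ss n). length ss \<le> length ts"
  using assms(2,4)
proof (induction ss)
  case Nil
  then show ?case
    using atomic assms(3) by fastforce
next
  case (Cons s ss)
  have s: "s \<in> S" "s \<notin> Units R" "s \<in> carrier R" and ss: "set ss \<subseteq> S - Units R"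
    using Cons.prems by auto
  have nz: "foldr (smult M) ss n \<noteq> \<zero>\<^bsub>M\<^esub>"
    using Cons.prems(2) s(3) by auto
  then obtain ts q where tq: "(ts, q) \<in> S_atomic_factorizations R M S (foldr (smult M) ss n)"
      and len: "length ss \<le> length ts"
    using Cons.IH ss by blast
  note q = S_atomic_factorization_mprim[OF tq nz]
  have qc: "q \<in> carrier M" "q \<noteq> \<zero>\<^bsub>M\<^esub>"
    using q(1) mprimD by blast+
  have sq: "s \<odot>\<^bsub>M\<^esub> q \<in> carrier M - {\<zero>\<^bsub>M\<^esub>}"
    using qc smult_nonzero[OF s(1) qc] s(3) by simp
  then obtain vs q' where vq: "(vs, q') \<in> S_atomic_factorizations R M S (s \<odot>\<^bsub>M\<^esub> q)"
    using atomic by fast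
  have q': "mprim q'" "s \<odot>\<^bsub>M\<^esub> q = foldr (smult M) vs q'"
    using S_atomic_factorization_mprim[OF vq] sq by simp_all
  \<comment> \<open>Without any factor \<open>s q\<close> would itself be primitive, forcing the
    nonunit \<open>s\<close> to be a unit.\<close>
  have "vs \<noteq> []"
  proof
    assume "vs = []"
    then have "q' = s \<odot>\<^bsub>M\<^esub> q"
      using q'(2) by simp
    then show False
      using mprimD(3)[OF q'(1)] s qc by blast
  qed
  then have "length (s # ss) \<le> length (ts @ vs)"
    using len by (cases vs) auto
  moreover have "foldr (smult M) (ts @ vs) q' = foldr (smult M) (s # ss) n"
    using q s qc by (simp add: foldr_smult_smult subset_iff flip: q'(2))
  then have "(ts @ vs, q') \<in> S_atomic_factorizations R M S (foldr (smult M) (s # ss) n)"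
    using tq vq by (simp add: S_atomic_factorizations_iff ball_Un)
  ultimately show ?case
    by blast
qed

text \<open>A type records the length whatever \<open>l\<close> is, so finitely many types mean
  bounded lengths of atomic factorizations; any other factorization refines to an atomic one at
  least as long.\<close>

lemma few_types_imp_bounded:
  assumes "few_types k l R M S (carrier M - {\<zero>\<^bsub>M\<^esub>})"
  shows "bounded_factorization R M S"
  unfolding bounded_factorization_def
proof
  fix m assume m: "m \<in> carrier M - {\<zero>\<^bsub>M\<^esub>}"
  let ?F = "S_atomic_factorizations R M S m"
  have atomic: "\<forall>m\<in>carrier M - {\<zero>\<^bsub>M\<^esub>}. S_atomic_factorizations R M S m \<noteq> {}"
    using assms unfolding few_types_def by blast
  have "finite (fact_type l R M S ` ?F)"
    using assms m unfolding few_types_def few_def by blast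
  then have "finite (fst ` fact_type l R M S ` ?F)"
    by (rule finite_imageI)
  then obtain N where N: "\<forall>k \<in> fst ` fact_type l R M S ` ?F. k \<le> N"
    using finite_nat_set_iff_bounded_le by blast
  have "length ss \<le> N" if "(ss, n) \<in> S_factorizations R M S m" for ss n
  proof -
    have "\<exists>(ts, q) \<in> ?F. length ss \<le> length ts"
      using S_factorization_refine[OF atomic, of ss n] that m by (simp add: S_factorizations_iff)
    then obtain ts q where tq: "(ts, q) \<in> ?F" "length ss \<le> length ts"
      by blast
    have "length ts \<in> fst ` fact_type l R M S ` ?F"
      using tq(1) by (force simp: fact_type_def image_image)
    then show ?thesis
      using N tq(2) by (meson le_trans)
  qed
  then show "\<exists>N. \<forall>(ss, n)\<in>S_factorizations R M S m. length ss \<le> N"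
    by blast
qed

text \<open>A nonunit \<open>s\<close> in \<open>S\<close> split off from \<open>a\<close>
  contributes one more factor to the factorizations of \<open>a m\<close>. The element
  \<open>m\<close> stays fixed while \<open>a\<close> varies, and the induction is on the length
  bound.\<close>

lemma bounded_imp_compactly_atomic:
  assumes "bounded_factorization R M S" "a \<in> live"
  shows "\<exists>s\<in>S. \<exists>b. rprim b \<and> a = s \<otimes> b"
proof -
  obtain m where m: "m \<in> carrier M" "a \<odot>\<^bsub>M\<^esub> m \<noteq> \<zero>\<^bsub>M\<^esub>"
    using assms(2) by (auto simp: live_iff)
  have aR: "a \<in> carrier R"
    using assms(2) by (simp add: live_iff)
  obtain N where "\<forall>(ss, n)\<in>S_factorizations R M S (a \<odot>\<^bsub>M\<^esub> m). length ss \<le> N"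
    using assms(1) m aR unfolding bounded_factorization_def by fastforce
  then show ?thesis
    using m(2) aR
  proof (induction N arbitrary: a)
    case (0 a)
    have "a \<in> live"
      using 0 m(1) by (auto simp: live_iff)
    moreover have "s \<in> Units R" if "s \<in> S" "b \<in> carrier R" "a = s \<otimes> b" for s b
    proof (rule ccontr)
      assume "s \<notin> Units R"
      then have "([s], b \<odot>\<^bsub>M\<^esub> m) \<in> S_factorizations R M S (a \<odot>\<^bsub>M\<^esub> m)"
        using that m(1) by (simp add: S_factorizations_iff smult_assoc1)
      then show False
        using 0(1) by fastforce
    qed
    ultimately have "rprim a"
      unfolding rprim_def by blast
    then show ?case
      using 0(3) by (intro bexI[of _ \<one>] exI[of _ a]) simp_all
  next
    case (Suc N a)
    have live: "a \<in> live"
      using Suc.prems m(1) by (auto simp: live_iff)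
    show ?case
    proof (cases "rprim a")
      case True
      then show ?thesis
        using Suc.prems by (intro bexI[of _ \<one>] exI[of _ a]) simp_all
    next
      case False
      then obtain s b where s: "s \<in> S" "s \<notin> Units R" and b: "b \<in> carrier R" and eq: "a = s \<otimes> b"
        using live unfolding rprim_def by blast
      have am: "a \<odot>\<^bsub>M\<^esub> m = s \<odot>\<^bsub>M\<^esub> (b \<odot>\<^bsub>M\<^esub> m)"
        using s b m(1) by (simp add: eq smult_assoc1)
      have "length ss \<le> N" if "(ss, n) \<in> S_factorizations R M S (b \<odot>\<^bsub>M\<^esub> m)" for ss n
      proof -
        have "(s # ss, n) \<in> S_factorizations R M S (a \<odot>\<^bsub>M\<^esub> m)"
          using that s by (simp add: S_factorizations_iff am)
        then show ?thesis
          using Suc.prems(1) by fastforce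
      qed
      moreover have "b \<odot>\<^bsub>M\<^esub> m \<noteq> \<zero>\<^bsub>M\<^esub>"
        using Suc.prems(2) s(1) am by auto
      ultimately obtain t c where t: "t \<in> S" "rprim c" "b = t \<otimes> c"
        using Suc.IH b by blast
      then have "s \<otimes> t \<in> S" "a = s \<otimes> t \<otimes> c"
        using s rprimD(2)[of c] by (simp_all add: eq R.m_assoc)
      then show ?thesis
        using t by blast
    qed
  qed
qed

end

section \<open>Factorizations with respect to \<open>S'\<close> and to \<open>S\<close>\<close>

locale splitting_pair = splitting_set +
  fixes S'
  assumes saturated': "saturated_mult R S'" and S_subset: "S \<subseteq> S'"
begin

sublocale S': module_loc R M S'
  using saturated' by (simp add: module_loc_def module_axioms saturated_mult_def)

lemma saturatedD': "a \<otimes> b \<in> S' \<Longrightarrow> a \<in> carrier R \<Longrightarrow> b \<in> carrier R \<Longrightarrow> a \<in> S' \<and> b \<in> S'"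
  using saturated' unfolding saturated_mult_def by blast

lemma Units_subset': "Units R \<subseteq> S'"
  using Units_subset S_subset by blast

text \<open>Here \<open>n = s x\<close> and \<open>x = t n\<close> with \<open>t\<close> only in
  \<open>S'\<close>, so \<open>S_presimplifiable\<close> does not apply to \<open>s t\<close>.
  Cancelling the \<open>S\<close>-part \<open>u\<close> of \<open>n = u p\<close> gives
  \<open>p = s (t p)\<close>, and primitivity of \<open>p\<close> makes \<open>s\<close> a
  unit.\<close>

lemma S'_primitive_imp_mprim:
  assumes n: "S_primitive M S' n" "n \<noteq> \<zero>\<^bsub>M\<^esub>"
  shows "mprim n"
proof -
  have nc: "n \<in> carrier M"
    using n by (simp add: S_primitive_def)
  then obtain u p where u: "u \<in> S" "mprim p" "n = u \<odot>\<^bsub>M\<^esub> p"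
    using n(2) mprim_factorizationE by blast
  have pc: "p \<in> carrier M"
    using u mprimD by blast
  have "s \<in> Units R" if s: "s \<in> S" and x: "x \<in> carrier M" and eq: "n = s \<odot>\<^bsub>M\<^esub> x" for s x
  proof -
    have "S_sim M S' x n"
      using n(1) s x eq S_subset unfolding S_primitive_def by blast
    then obtain t where t: "t \<in> S'" "x = t \<odot>\<^bsub>M\<^esub> n"
      unfolding S_sim_def by blast
    have "u \<odot>\<^bsub>M\<^esub> (s \<odot>\<^bsub>M\<^esub> (t \<odot>\<^bsub>M\<^esub> p)) = s \<odot>\<^bsub>M\<^esub> (t \<odot>\<^bsub>M\<^esub> n)"
      using u(1) s t(1) pc by (simp add: u(3) smult_swap[of u])
    also have "\<dots> = u \<odot>\<^bsub>M\<^esub> p"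
      by (simp flip: t(2) eq u(3))
    finally have "p = s \<odot>\<^bsub>M\<^esub> (t \<odot>\<^bsub>M\<^esub> p)"
      using u(1) s t(1) pc by (rule_tac smult_cancel[symmetric]) auto
    then show ?thesis
      using mprimD(3)[OF u(2), of s "t \<odot>\<^bsub>M\<^esub> p"] s t(1) pc by simp
  qed
  then show ?thesis
    unfolding mprim_def using nc n(2) by blast
qed

text \<open>As \<open>m\<close> is nonzero, every factor acts nontrivially. Those outside
  \<open>S\<close> are then primitive, and so is the nonzero element \<open>q\<close> that they
  produce from the primitive \<open>n\<close>.\<close>

lemma atomic_factorization_split:
  assumes f: "(ss, n) \<in> S_atomic_factorizations R M S' m" and m: "m \<noteq> \<zero>\<^bsub>M\<^esub>"
  defines "q \<equiv> foldr (smult M) (filter (\<lambda>s. s \<notin> S) ss) n"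
  shows "(filter (\<lambda>s. s \<in> S) ss, q) \<in> S_atomic_factorizations R M S m"
    "(filter (\<lambda>s. s \<notin> S) ss, n) \<in> S_atomic_factorizations R M S' q"
    "mprim q" "m = foldr (smult M) (filter (\<lambda>s. s \<in> S) ss) q"
proof -
  have f': "set ss \<subseteq> S' - Units R" "\<forall>s\<in>set ss. irred R s" "S_primitive M S' n"
      "m = foldr (smult M) ss n"
    using f by (simp_all add: S'.S_atomic_factorizations_iff)
  then have ss: "set ss \<subseteq> carrier R" and n: "n \<in> carrier M"
    by (auto simp: S_primitive_def)
  have "n \<noteq> \<zero>\<^bsub>M\<^esub>"
    using m ss f'(4) by auto
  then have "mprim n"
    using S'_primitive_imp_mprim f'(3) by blast
  show eq: "m = foldr (smult M) (filter (\<lambda>s. s \<in> S) ss) q"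
    using foldr_smult_partition[OF ss n, of "\<lambda>s. s \<in> S"] f'(4) by (simp add: q_def)
  have "q \<noteq> \<zero>\<^bsub>M\<^esub>"
  proof
    assume "q = \<zero>\<^bsub>M\<^esub>"
    moreover have "set (filter (\<lambda>s. s \<in> S) ss) \<subseteq> carrier R"
      by auto
    ultimately show False
      using eq m by simp
  qed
  moreover have "set ss \<subseteq> live"
    using foldr_smult_live ss n f'(4) m by blast
  then have "\<forall>s \<in> set (filter (\<lambda>s. s \<notin> S) ss). rprim s"
    using f'(2) irred_imp_rprim by auto
  ultimately show q: "mprim q"
    unfolding q_def using mprim_foldr_smult \<open>mprim n\<close> by blast
  then have "S_primitive M S q"
    using S_primitive_iff_mprim mprimD(2) by blast
  moreover have "set (filter (\<lambda>s. s \<in> S) ss) \<subseteq> S - Units R"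
    using f'(1) by auto
  ultimately show "(filter (\<lambda>s. s \<in> S) ss, q) \<in> S_atomic_factorizations R M S m"
    unfolding S_atomic_factorizations_iff using f'(2) eq by auto
  show "(filter (\<lambda>s. s \<notin> S) ss, n) \<in> S_atomic_factorizations R M S' q"
    unfolding S'.S_atomic_factorizations_iff q_def using f'(1-3) by auto
qed

text \<open>Primitive parts are only determined up to units. The unit is absorbed by the last
  element, so that the scalars and the type stay the same.\<close>

lemma atomic_factorization_unit_smult:
  assumes "e \<in> Units R" "(ss, n) \<in> S_atomic_factorizations R M S' m"
  shows "(ss, e \<odot>\<^bsub>M\<^esub> n) \<in> S_atomic_factorizations R M S' (e \<odot>\<^bsub>M\<^esub> m)"
    "sim_class M S' (e \<odot>\<^bsub>M\<^esub> n) = sim_class M S' n"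
proof -
  have f: "set ss \<subseteq> S' - Units R" "\<forall>s\<in>set ss. irred R s" "S_primitive M S' n"
      "m = foldr (smult M) ss n"
    using assms(2) by (simp_all add: S'.S_atomic_factorizations_iff)
  then have ss: "set ss \<subseteq> carrier R" and n: "n \<in> carrier M" and e: "e \<in> carrier R"
    using assms(1) by (auto simp: S_primitive_def)
  note u = S'.S_primitive_unit_smult[OF Units_subset' assms(1) f(3)]
  show "(ss, e \<odot>\<^bsub>M\<^esub> n) \<in> S_atomic_factorizations R M S' (e \<odot>\<^bsub>M\<^esub> m)"
    unfolding S'.S_atomic_factorizations_iff f(4)
    using f(1,2) u(1) foldr_smult_smult[OF ss e n] by simp
  show "sim_class M S' (e \<odot>\<^bsub>M\<^esub> n) = sim_class M S' n"
    using S'.sim_class_eq_iff[OF n, of "e \<odot>\<^bsub>M\<^esub> n"] u(2) e n by simp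
qed

lemma mprim_foldr_unique:
  assumes "set ts \<subseteq> S" "mprim q" "s \<in> S" "mprim p" "s \<odot>\<^bsub>M\<^esub> p = foldr (smult M) ts q"
  shows "\<exists>e\<in>Units R. q = e \<odot>\<^bsub>M\<^esub> p"
proof -
  obtain a where "a \<in> S" "foldr (smult M) ts q = a \<odot>\<^bsub>M\<^esub> q"
    using foldr_smult_scalar[OF submonoid_axioms assms(1)] mprimD(1)[OF assms(2)] by blast
  then show ?thesis
    using mprim_factorization_unique[OF assms(3) _ assms(4,2)] assms(5) by auto
qed

text \<open>The end \<open>q\<close> of the \<open>S\<close>-atomic factorization is
  \<open>e p\<close> for a unit \<open>e\<close>, so a factorization of \<open>p\<close> continues
  it once its end is multiplied by \<open>e\<close>.\<close>

lemma atomic_factorization_join: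
  assumes f: "(ts, q) \<in> S_atomic_factorizations R M S m" and m: "m \<noteq> \<zero>\<^bsub>M\<^esub>"
    and s: "s \<in> S" "mprim p" "m = s \<odot>\<^bsub>M\<^esub> p" and g: "(vs, n) \<in> S_atomic_factorizations R M S' p"
  shows "\<exists>e\<in>Units R. (ts @ vs, e \<odot>\<^bsub>M\<^esub> n) \<in> S_atomic_factorizations R M S' m"
proof -
  note q = S_atomic_factorization_mprim[OF f m]
  then obtain e where e: "e \<in> Units R" "q = e \<odot>\<^bsub>M\<^esub> p"
    using mprim_foldr_unique[OF _ q(1) s(1,2), of ts] s(3) by auto
  have "(vs, e \<odot>\<^bsub>M\<^esub> n) \<in> S_atomic_factorizations R M S' q"
    using atomic_factorization_unit_smult(1)[OF e(1) g] e(2) by simp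
  then have "(ts @ vs, e \<odot>\<^bsub>M\<^esub> n) \<in> S_atomic_factorizations R M S' m"
    using f q S_subset
    by (simp add: S_atomic_factorizations_iff S'.S_atomic_factorizations_iff ball_Un) blast
  then show ?thesis
    using e(1) by blast
qed

text \<open>Both ends are unit multiples of the primitive part of \<open>m\<close>. Hence the type
  of an \<open>S\<close>-atomic factorization of \<open>m\<close> depends on its scalars
  alone.\<close>

lemma S_atomic_factorization_class_unique:
  assumes "(ts, q) \<in> S_atomic_factorizations R M S m" "(ts', q') \<in> S_atomic_factorizations R M S m"
    and "m \<in> carrier M" "m \<noteq> \<zero>\<^bsub>M\<^esub>"
  shows "sim_class M S q = sim_class M S q'"
proof -
  obtain s p where s: "s \<in> S" "mprim p" "m = s \<odot>\<^bsub>M\<^esub> p"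
    using assms mprim_factorizationE by blast
  have p: "S_primitive M S p" "p \<in> carrier M"
    using s S_primitive_iff_mprim mprimD by blast+
  have "sim_class M S q = sim_class M S p" if "(ts, q) \<in> S_atomic_factorizations R M S m" for ts q
  proof -
    note q = S_atomic_factorization_mprim[OF that assms(4)]
    then obtain e where e: "e \<in> Units R" "q = e \<odot>\<^bsub>M\<^esub> p"
      using mprim_foldr_unique[OF _ q(1) s(1,2), of ts] s(3) by auto
    then show ?thesis
      using S_primitive_unit_smult(2)[OF Units_subset e(1) p(1)] sim_class_eq_iff[OF p(2), of q]
        mprimD(1)[OF q(1)] by simp
  qed
  then show ?thesis
    using assms(1,2) by metis
qed

text \<open>Appending a fixed factorization of the primitive part turns
  \<open>S\<close>-factorizations into \<open>S'\<close>-factorizations without merging types. In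
  the other direction the types of the two parts of an \<open>S'\<close>-factorization determine its
  type, so it suffices to control pairs of types.\<close>

lemma few_types_split:
  "few_types k l R M S' (carrier M - {\<zero>\<^bsub>M\<^esub>}) \<longleftrightarrow>
    few_types k l R M S (carrier M - {\<zero>\<^bsub>M\<^esub>}) \<and> few_types k l R M S' {p. mprim p}"
    (is "?L \<longleftrightarrow> ?R1 \<and> ?R2")
proof (intro iffI conjI)
  assume L: ?L
  then show ?R2
    unfolding few_types_def using mprimD by blast
  show ?R1
    unfolding few_types_def
  proof
    fix m assume "m \<in> carrier M - {\<zero>\<^bsub>M\<^esub>}"
    then have m: "m \<in> carrier M" "m \<noteq> \<zero>\<^bsub>M\<^esub>"
      by auto
    let ?F = "S_atomic_factorizations R M S" and ?F' = "S_atomic_factorizations R M S'"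
    obtain s p where s: "s \<in> S" "mprim p" "m = s \<odot>\<^bsub>M\<^esub> p"
      using m mprim_factorizationE by blast
    have F': "?F' m \<noteq> {}" "few k (fact_type l R M S' ` ?F' m)"
      using L m unfolding few_types_def by blast+
    have "?F' p \<noteq> {}"
      using \<open>?R2\<close> s(2) unfolding few_types_def by blast
    then obtain vs n where vs: "(vs, n) \<in> ?F' p"
      by auto
    obtain ss n' where "(ss, n') \<in> ?F' m"
      using F'(1) by auto
    then have "?F m \<noteq> {}"
      using atomic_factorization_split(1) m(2) by blast
    moreover
    have "\<forall>f\<in>?F m. \<exists>g\<in>?F' m. fst g = fst f @ vs"
    proof
      fix f assume "f \<in> ?F m"
      moreover obtain ts q where "f = (ts, q)"
        by (cases f)
      ultimately show "\<exists>g\<in>?F' m. fst g = fst f @ vs"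
        using atomic_factorization_join[OF _ m(2) s vs, of ts q] by force
    qed
    then obtain h where h: "\<forall>f\<in>?F m. h f \<in> ?F' m \<and> fst (h f) = fst f @ vs"
      by metis
    have "few k (fact_type l R M S ` ?F m)"
    proof (rule few_image_transfer[OF F'(2)])
      show "h ` ?F m \<subseteq> ?F' m"
        using h by blast
      fix f g
      assume fg: "f \<in> ?F m" "g \<in> ?F m" and eq: "fact_type l R M S' (h f) = fact_type l R M S' (h g)"
      obtain ts q ts' q' where f: "f = (ts, q)" and g: "g = (ts', q')"
        by (cases f; cases g)
      \<comment> \<open>The common tail \<open>vs\<close> cancels from lengths and multisets, and
        the class of the end is the same for all \<open>S\<close>-atomic factorizations of
        \<open>m\<close>.\<close>
      have "sim_class M S q = sim_class M S q'"
        using S_atomic_factorization_class_unique fg m f g by blast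
      moreover have "fst (h f) = ts @ vs" "fst (h g) = ts' @ vs"
        using h fg f g by simp_all
      ultimately show "fact_type l R M S f = fact_type l R M S g"
        using eq unfolding f g fact_type_def by (auto simp: case_prod_beta split: if_splits)
    qed
    ultimately show "?F m \<noteq> {} \<and> few k (fact_type l R M S ` ?F m)"
      by blast
  qed
next
  assume R: "?R1 \<and> ?R2"
  show ?L
    unfolding few_types_def
  proof
    fix m assume "m \<in> carrier M - {\<zero>\<^bsub>M\<^esub>}"
    then have m: "m \<in> carrier M" "m \<noteq> \<zero>\<^bsub>M\<^esub>"
      by auto
    let ?F = "S_atomic_factorizations R M S" and ?F' = "S_atomic_factorizations R M S'"
    let ?j = "map_prod (fact_type l R M S) (fact_type l R M S')"
    obtain s p where s: "s \<in> S" "mprim p" "m = s \<odot>\<^bsub>M\<^esub> p"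
      using m mprim_factorizationE by blast
    have F: "?F m \<noteq> {}" "few k (fact_type l R M S ` ?F m)"
      and F': "?F' p \<noteq> {}" "few k (fact_type l R M S' ` ?F' p)"
      using R m s(2) unfolding few_types_def by blast+
    obtain ts q vs n where "(ts, q) \<in> ?F m" "(vs, n) \<in> ?F' p"
      using F(1) F'(1) by auto
    then have "?F' m \<noteq> {}"
      using atomic_factorization_join[OF _ m(2) s] by blast
    moreover
    \<comment> \<open>The unit between \<open>q\<close> and \<open>p\<close> varies with
      \<open>f\<close>. Multiplying by its inverse turns all tails into factorizations of one
      \<open>p\<close> and keeps the class of the end.\<close>
    have ex: "\<exists>g \<in> ?F m \<times> ?F' p. fst (fst g) = filter (\<lambda>s. s \<in> S) (fst f) \<and>
        fst (snd g) = filter (\<lambda>s. s \<notin> S) (fst f) \<and> sim_class M S' (snd (snd g)) = sim_class M S' (snd f)"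
      if f: "f \<in> ?F' m" for f
    proof -
      obtain ss n where ss: "f = (ss, n)"
        by (cases f)
      define q where "q = foldr (smult M) (filter (\<lambda>s. s \<notin> S) ss) n"
      note A = atomic_factorization_split[OF f[unfolded ss] m(2), folded q_def]
      have "set (filter (\<lambda>s. s \<in> S) ss) \<subseteq> S"
        by auto
      then obtain e where e: "e \<in> Units R" "q = e \<odot>\<^bsub>M\<^esub> p"
        using mprim_foldr_unique[OF _ A(3) s(1,2), of "filter (\<lambda>s. s \<in> S) ss"] A(4) s(3)
        by auto
      have "p = inv e \<odot>\<^bsub>M\<^esub> q"
        using e mprimD(1)[OF s(2)] by (simp add: smult_inv)
      then have "((filter (\<lambda>s. s \<in> S) ss, q), (filter (\<lambda>s. s \<notin> S) ss, inv e \<odot>\<^bsub>M\<^esub> n)) \<in> ?F m \<times> ?F' p"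
        using A(1) atomic_factorization_unit_smult(1)[OF _ A(2), of "inv e"] e(1) by simp
      moreover have "sim_class M S' (inv e \<odot>\<^bsub>M\<^esub> n) = sim_class M S' n"
        using atomic_factorization_unit_smult(2)[OF _ A(2), of "inv e"] e(1) by simp
      ultimately show ?thesis
        unfolding ss by force
    qed
    obtain h where h: "\<forall>f\<in>?F' m. h f \<in> ?F m \<times> ?F' p \<and> fst (fst (h f)) = filter (\<lambda>s. s \<in> S) (fst f) \<and>
        fst (snd (h f)) = filter (\<lambda>s. s \<notin> S) (fst f) \<and>
        sim_class M S' (snd (snd (h f))) = sim_class M S' (snd f)"
      using bchoice[of "?F' m"] ex by metis
    have "few k (?j ` (?F m \<times> ?F' p))"
      using few_Times[OF F(2) F'(2)] by (rule few_subset) auto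
    then have "few k (fact_type l R M S' ` ?F' m)"
    proof (rule few_image_transfer)
      show "h ` ?F' m \<subseteq> ?F m \<times> ?F' p"
        using h by blast
      fix f g
      assume fg: "f \<in> ?F' m" "g \<in> ?F' m" and eq: "?j (h f) = ?j (h g)"
      obtain ss n ss' n' where f: "f = (ss, n)" and g: "g = (ss', n')"
        by (cases f; cases g)
      obtain x y x' y' where hf: "h f = ((filter (\<lambda>s. s \<in> S) ss, x), (filter (\<lambda>s. s \<notin> S) ss, y))"
          and hg: "h g = ((filter (\<lambda>s. s \<in> S) ss', x'), (filter (\<lambda>s. s \<notin> S) ss', y'))"
          and y: "sim_class M S' y = sim_class M S' n" "sim_class M S' y' = sim_class M S' n'"
        using h fg unfolding f g by (metis fst_conv snd_conv prod.collapse)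
      have *: "mset (map c ss) = mset (map c (filter (\<lambda>s. s \<in> S) ss)) + mset (map c (filter (\<lambda>s. s \<notin> S) ss))"
        for c :: "'a \<Rightarrow> 'a set" and ss
        by (induction ss) auto
      have **: "length ss = length (filter (\<lambda>s. s \<in> S) ss) + length (filter (\<lambda>s. s \<notin> S) ss)" for ss
        by (induction ss) auto
      show "fact_type l R M S' f = fact_type l R M S' g"
        using eq y *[of _ ss] *[of _ ss'] **[of ss] **[of ss'] unfolding f g hf[unfolded f] hg[unfolded g] fact_type_def
        by (auto split: if_splits)
    qed
    ultimately show "?F' m \<noteq> {} \<and> few k (fact_type l R M S' ` ?F' m)"
      by blast
  qed
qed

end

section \<open>Fractions and their primitive parts\<close>

context splitting_pair
begin

abbreviation RS where "RS \<equiv> loc_ring R S"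
abbreviation MS where "MS \<equiv> loc_module R M S"
abbreviation T where "T \<equiv> loc_subset R S S'"
abbreviation frac where "frac \<equiv> loc_frac R (self_module R) S"
abbreviation mfrac where "mfrac \<equiv> loc_frac R M S"

interpretation L: module_loc R "self_module R" S
  by (rule module_loc_self)

text \<open>Regularity of \<open>S\<close> on \<open>M\<close> cancels the extra factor
  \<open>u\<close> of \<open>loc_rel\<close>.\<close>

lemma mfrac_eq_iff:
  assumes "m \<in> carrier M" "s \<in> S" "n \<in> carrier M" "t \<in> S"
  shows "mfrac m s = mfrac n t \<longleftrightarrow> t \<odot>\<^bsub>M\<^esub> m = s \<odot>\<^bsub>M\<^esub> n"
proof
  assume "mfrac m s = mfrac n t"
  then obtain u where "u \<in> S" "u \<odot>\<^bsub>M\<^esub> (t \<odot>\<^bsub>M\<^esub> m) = u \<odot>\<^bsub>M\<^esub> (s \<odot>\<^bsub>M\<^esub> n)"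
    using assms by (auto simp: loc_frac_eq_iff)
  then show "t \<odot>\<^bsub>M\<^esub> m = s \<odot>\<^bsub>M\<^esub> n"
    using assms by (rule_tac smult_cancel) auto
qed (rule loc_frac_eqI[OF assms])

lemma frac_eq_iff:
  assumes "a \<in> carrier R" "s \<in> S" "b \<in> carrier R" "t \<in> S"
  shows "frac a s = frac b t \<longleftrightarrow> t \<otimes> a = s \<otimes> b"
proof
  assume "frac a s = frac b t"
  then obtain u where "u \<in> S" "u \<otimes> (t \<otimes> a) = u \<otimes> (s \<otimes> b)"
    using assms by (auto simp: L.loc_frac_eq_iff)
  then show "t \<otimes> a = s \<otimes> b"
    using assms by (rule_tac mult_cancel) auto
qed (use L.loc_frac_eqI[of a s b t] assms in simp)

lemma frac_carrier [simp]: "a \<in> carrier R \<Longrightarrow> s \<in> S \<Longrightarrow> frac a s \<in> carrier RS"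
  by (auto simp: carrier_loc_ring)

lemma frac_carrierE:
  assumes "x \<in> carrier RS"
  obtains a s where "a \<in> carrier R" "s \<in> S" "x = frac a s"
  using assms by (auto simp: carrier_loc_ring)

lemma mfrac_carrierE:
  assumes "y \<in> carrier MS"
  obtains m s where "m \<in> carrier M" "s \<in> S" "y = mfrac m s"
  using assms by (auto simp: carrier_loc_module)

lemma mfrac_zero_iff:
  assumes "m \<in> carrier M" "s \<in> S"
  shows "mfrac m s = \<zero>\<^bsub>MS\<^esub> \<longleftrightarrow> m = \<zero>\<^bsub>M\<^esub>"
proof -
  have "\<zero>\<^bsub>MS\<^esub> = mfrac \<zero>\<^bsub>M\<^esub> \<one>"
    by (simp add: loc_module_def)
  then show ?thesis
    using assms by (simp add: mfrac_eq_iff)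
qed

lemma one_RS: "\<one>\<^bsub>RS\<^esub> = frac \<one> \<one>"
  by (simp add: loc_ring_def)

text \<open>Another representative \<open>b / t\<close> may witness membership; saturation of
  \<open>S'\<close> passes it on to \<open>a\<close>.\<close>

lemma frac_in_T_iff:
  assumes "a \<in> carrier R" "s \<in> S"
  shows "frac a s \<in> T \<longleftrightarrow> a \<in> S'"
proof
  assume "frac a s \<in> T"
  then obtain b t where b: "b \<in> S'" "t \<in> S" "frac a s = frac b t"
    by (auto simp: loc_subset_def)
  then have "t \<otimes> a = s \<otimes> b"
    using assms S'.S_R by (simp add: frac_eq_iff)
  moreover have "s \<otimes> b \<in> S'"
    using b assms S_subset S'.m_closed by blast
  ultimately show "a \<in> S'"
    using saturatedD'[of t a] assms b by simp
qed (use assms in \<open>auto simp: loc_subset_def\<close>)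

lemma T_fracE:
  assumes "x \<in> T"
  obtains a s where "a \<in> S'" "s \<in> S" "x = frac a s"
  using assms by (auto simp: loc_subset_def)

sublocale RS: module_loc RS MS T
proof -
  have "submonoid T RS"
  proof
    show "T \<subseteq> carrier RS"
      by (auto simp: loc_subset_def)
    show "\<one>\<^bsub>RS\<^esub> \<in> T"
      by (simp add: one_RS frac_in_T_iff)
    fix x y assume "x \<in> T" "y \<in> T"
    then obtain a s b t where "a \<in> S'" "s \<in> S" "x = frac a s" "b \<in> S'" "t \<in> S" "y = frac b t"
      by (meson T_fracE)
    then show "x \<otimes>\<^bsub>RS\<^esub> y \<in> T"
      by (simp add: loc_ring_mult frac_in_T_iff)
  qed
  then show "module_loc RS MS T"
    by (simp add: module_loc_def module_loc_module)
qed

lemma frac_Units_iff: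
  assumes "a \<in> carrier R" "s \<in> S"
  shows "frac a s \<in> Units RS \<longleftrightarrow> a \<in> S"
proof
  assume "frac a s \<in> Units RS"
  then obtain y where "y \<in> carrier RS" "frac a s \<otimes>\<^bsub>RS\<^esub> y = \<one>\<^bsub>RS\<^esub>"
    by (auto simp: Units_def)
  then obtain b t where b: "b \<in> carrier R" "t \<in> S" "frac a s \<otimes>\<^bsub>RS\<^esub> frac b t = \<one>\<^bsub>RS\<^esub>"
    by (metis frac_carrierE)
  then have "a \<otimes> b = s \<otimes> t"
    using assms by (simp add: loc_ring_mult one_RS frac_eq_iff)
  then have "a \<otimes> b \<in> S"
    using assms b by simp
  then show "a \<in> S"
    using saturatedD assms b by blast
next
  assume "a \<in> S"
  then have "frac a s \<otimes>\<^bsub>RS\<^esub> frac s a = \<one>\<^bsub>RS\<^esub>" "frac s a \<otimes>\<^bsub>RS\<^esub> frac a s = \<one>\<^bsub>RS\<^esub>"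
    using assms by (simp_all add: loc_ring_mult one_RS frac_eq_iff R.m_comm)
  then show "frac a s \<in> Units RS"
    unfolding Units_def using assms \<open>a \<in> S\<close> by auto
qed

text \<open>
  \<open>lifts x a\<close> and \<open>mlifts y n\<close> say that \<open>a\<close> and \<open>n\<close> are the parts of the fractions \<open>x\<close> and \<open>y\<close> that
  are left after all factors from \<open>S\<close> are removed.
\<close>

definition lifts :: "('a \<times> 'a) set \<Rightarrow> 'a \<Rightarrow> bool"
  where "lifts x a \<longleftrightarrow> rprim a \<and> (\<exists>u\<in>S. \<exists>t\<in>S. x = frac (u \<otimes> a) t)"

definition mlifts :: "('c \<times> 'a) set \<Rightarrow> 'c \<Rightarrow> bool"
  where "mlifts y n \<longleftrightarrow> mprim n \<and> (\<exists>u\<in>S. \<exists>t\<in>S. y = mfrac (u \<odot>\<^bsub>M\<^esub> n) t)"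

lemma liftsE:
  assumes "lifts x a"
  obtains u t where "u \<in> S" "t \<in> S" "x = frac (u \<otimes> a) t" "rprim a" "a \<in> carrier R"
  using assms rprimD(2) unfolding lifts_def by blast

lemma mliftsE:
  assumes "mlifts y n"
  obtains u t where "u \<in> S" "t \<in> S" "y = mfrac (u \<odot>\<^bsub>M\<^esub> n) t" "mprim n" "n \<in> carrier M"
  using assms mprimD(1) unfolding mlifts_def by blast

lemma lifts_carrier: "lifts x a \<Longrightarrow> x \<in> carrier RS"
  by (erule liftsE) simp

lemma mlifts_carrier: "mlifts y n \<Longrightarrow> y \<in> carrier MS"
  by (erule mliftsE) simp

lemma mlifts_nonzero: "mlifts y n \<Longrightarrow> y \<noteq> \<zero>\<^bsub>MS\<^esub>"
  by (erule mliftsE) (simp add: mfrac_zero_iff smult_nonzero mprimD)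

lemma mlifts_ex:
  assumes "y \<in> carrier MS" "y \<noteq> \<zero>\<^bsub>MS\<^esub>"
  shows "\<exists>n. mlifts y n"
proof -
  obtain m s where m: "m \<in> carrier M" "s \<in> S" "y = mfrac m s"
    using assms by (meson mfrac_carrierE)
  then have "m \<noteq> \<zero>\<^bsub>M\<^esub>"
    using assms(2) by (simp add: mfrac_zero_iff)
  then obtain u p where "u \<in> S" "mprim p" "m = u \<odot>\<^bsub>M\<^esub> p"
    using m mprim_factorizationE by blast
  then show ?thesis
    unfolding mlifts_def using m by blast
qed

lemma mlifts_unit:
  assumes "mlifts y n" "e \<in> Units R" "mprim (e \<odot>\<^bsub>M\<^esub> n)"
  shows "mlifts y (e \<odot>\<^bsub>M\<^esub> n)"
proof -
  obtain u t where u: "u \<in> S" "t \<in> S" "y = mfrac (u \<odot>\<^bsub>M\<^esub> n) t" "n \<in> carrier M"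
    using assms(1) by (rule mliftsE)
  have e: "inv e \<in> S" "e \<in> carrier R"
    using assms(2) Units_subset by auto
  have "(u \<otimes> inv e) \<odot>\<^bsub>M\<^esub> (e \<odot>\<^bsub>M\<^esub> n) = u \<odot>\<^bsub>M\<^esub> n"
    using u e assms(2) by (simp add: smult_assoc1 smult_inv)
  then show ?thesis
    unfolding mlifts_def using assms(3) u e m_closed by metis
qed

text \<open>Cross-multiplying gives two compact factorizations of one element of \<open>M\<close>.
  The ambiguity is thus a unit of \<open>R\<close>, not merely of \<open>R_S\<close>, which is what
  lets factorizations be pulled back to \<open>R\<close>.\<close>

lemma mlifts_unique:
  assumes "mlifts y n" "mlifts y n'"
  shows "\<exists>e\<in>Units R. n' = e \<odot>\<^bsub>M\<^esub> n"
proof -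
  obtain u t where u: "u \<in> S" "t \<in> S" "y = mfrac (u \<odot>\<^bsub>M\<^esub> n) t" "mprim n" "n \<in> carrier M"
    using assms(1) by (rule mliftsE)
  obtain u' t' where u': "u' \<in> S" "t' \<in> S" "y = mfrac (u' \<odot>\<^bsub>M\<^esub> n') t'" "mprim n'" "n' \<in> carrier M"
    using assms(2) by (rule mliftsE)
  have "mfrac (u \<odot>\<^bsub>M\<^esub> n) t = mfrac (u' \<odot>\<^bsub>M\<^esub> n') t'"
    using u(3) u'(3) by simp
  then have "(t' \<otimes> u) \<odot>\<^bsub>M\<^esub> n = (t \<otimes> u') \<odot>\<^bsub>M\<^esub> n'"
    using u(1,2,5) u'(1,2,5) by (simp add: mfrac_eq_iff smult_assoc1)
  then show ?thesis
    using mprim_factorization_unique[of "t' \<otimes> u" "t \<otimes> u'" n n'] u u' by auto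
qed

lemma lifts_unit:
  assumes "lifts x a" "e \<in> Units R" "rprim (e \<otimes> a)"
  shows "lifts x (e \<otimes> a)"
proof -
  obtain u t where u: "u \<in> S" "t \<in> S" "x = frac (u \<otimes> a) t" "a \<in> carrier R"
    using assms(1) by (rule liftsE)
  have e: "inv e \<in> S" "e \<in> carrier R"
    using assms(2) Units_subset by auto
  have "(u \<otimes> inv e) \<otimes> (e \<otimes> a) = u \<otimes> (inv e \<otimes> e) \<otimes> a"
    using u e by (simp add: R.m_ac)
  then have "(u \<otimes> inv e) \<otimes> (e \<otimes> a) = u \<otimes> a"
    using u(1) assms(2) by simp
  then show ?thesis
    unfolding lifts_def using assms(3) u e m_closed by metis
qed

lemma lifts_unique:
  assumes "lifts x a" "lifts x b"
  shows "\<exists>e\<in>Units R. b = e \<otimes> a"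
proof -
  obtain u t where u: "u \<in> S" "t \<in> S" "x = frac (u \<otimes> a) t" "rprim a" "a \<in> carrier R"
    using assms(1) by (rule liftsE)
  obtain u' t' where u': "u' \<in> S" "t' \<in> S" "x = frac (u' \<otimes> b) t'" "rprim b" "b \<in> carrier R"
    using assms(2) by (rule liftsE)
  have "frac (u \<otimes> a) t = frac (u' \<otimes> b) t'"
    using u(3) u'(3) by simp
  then have "(t' \<otimes> u) \<otimes> a = (t \<otimes> u') \<otimes> b"
    using u(1,2,5) u'(1,2,5) by (simp add: frac_eq_iff R.m_assoc)
  then show ?thesis
    using rprim_cancel[of "t' \<otimes> u" "t \<otimes> u'" a b] u u' by auto
qed

lemma lifts_smult:
  assumes x: "lifts x a" and y: "mlifts y n" and nz: "x \<odot>\<^bsub>MS\<^esub> y \<noteq> \<zero>\<^bsub>MS\<^esub>"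
  shows "mlifts (x \<odot>\<^bsub>MS\<^esub> y) (a \<odot>\<^bsub>M\<^esub> n)"
proof -
  obtain u t where u: "u \<in> S" "t \<in> S" "x = frac (u \<otimes> a) t" "rprim a" "a \<in> carrier R"
    using x by (rule liftsE)
  obtain v w where v: "v \<in> S" "w \<in> S" "y = mfrac (v \<odot>\<^bsub>M\<^esub> n) w" "mprim n" "n \<in> carrier M"
    using y by (rule mliftsE)
  have "(u \<otimes> a) \<odot>\<^bsub>M\<^esub> (v \<odot>\<^bsub>M\<^esub> n) = (u \<otimes> v) \<odot>\<^bsub>M\<^esub> (a \<odot>\<^bsub>M\<^esub> n)"
    using u v by (simp add: R.m_ac flip: smult_assoc1)
  then have eq: "x \<odot>\<^bsub>MS\<^esub> y = mfrac ((u \<otimes> v) \<odot>\<^bsub>M\<^esub> (a \<odot>\<^bsub>M\<^esub> n)) (t \<otimes> w)"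
    using u v by (simp add: loc_frac_smult)
  then have "(u \<otimes> v) \<odot>\<^bsub>M\<^esub> (a \<odot>\<^bsub>M\<^esub> n) \<noteq> \<zero>\<^bsub>M\<^esub>"
    using nz u v by (simp add: mfrac_zero_iff)
  then have "a \<odot>\<^bsub>M\<^esub> n \<noteq> \<zero>\<^bsub>M\<^esub>"
    using u(1) v(1) by auto
  then have "mprim (a \<odot>\<^bsub>M\<^esub> n)"
    using mprim_smult u(4) v(4) by blast
  then show ?thesis
    unfolding mlifts_def using eq u(1,2) v(1,2) m_closed by blast
qed

lemma lifts_mult:
  assumes x: "lifts x a" and y: "lifts y b" and "a \<otimes> b \<in> live"
  shows "lifts (x \<otimes>\<^bsub>RS\<^esub> y) (a \<otimes> b)"
proof -
  obtain u t where u: "u \<in> S" "t \<in> S" "x = frac (u \<otimes> a) t" "rprim a" "a \<in> carrier R"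
    using x by (rule liftsE)
  obtain v w where v: "v \<in> S" "w \<in> S" "y = frac (v \<otimes> b) w" "rprim b" "b \<in> carrier R"
    using y by (rule liftsE)
  have "(u \<otimes> a) \<otimes> (v \<otimes> b) = (u \<otimes> v) \<otimes> (a \<otimes> b)"
    using u v by (simp add: R.m_ac)
  then have "x \<otimes>\<^bsub>RS\<^esub> y = frac ((u \<otimes> v) \<otimes> (a \<otimes> b)) (t \<otimes> w)"
    using u v by (simp add: loc_ring_mult)
  then show ?thesis
    unfolding lifts_def using rprim_mult[OF u(4) v(4) assms(3)] u(1,2) v(1,2) m_closed by blast
qed

lemma lifts_in_T_iff:
  assumes "lifts x a"
  shows "x \<in> T \<longleftrightarrow> a \<in> S'"
proof -
  obtain u t where u: "u \<in> S" "t \<in> S" "x = frac (u \<otimes> a) t" "a \<in> carrier R"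
    using assms by (rule liftsE)
  have "u \<otimes> a \<in> S' \<longleftrightarrow> a \<in> S'"
    using u S_subset S'.m_closed saturatedD'[of u a] by blast
  then show ?thesis
    using u by (simp add: frac_in_T_iff)
qed

text \<open>A primitive element of \<open>S\<close> is a unit of \<open>R\<close>, so inverting
  \<open>S\<close> makes no further primitive scalar invertible.\<close>

lemma lifts_Units_iff:
  assumes "lifts x a"
  shows "x \<in> Units RS \<longleftrightarrow> a \<in> Units R"
proof -
  obtain u t where u: "u \<in> S" "t \<in> S" "x = frac (u \<otimes> a) t" "rprim a" "a \<in> carrier R"
    using assms by (rule liftsE)
  have "u \<otimes> a \<in> S \<longleftrightarrow> a \<in> S"
    using u m_closed saturatedD[of u a] by blast
  also have "\<dots> \<longleftrightarrow> a \<in> Units R"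
    using rprim_in_S u(4) Units_subset by blast
  finally show ?thesis
    using u by (simp add: frac_Units_iff)
qed

lemma live_scale_iff:
  assumes "s \<in> S" "a \<in> carrier R"
  shows "s \<otimes> a \<in> live \<longleftrightarrow> a \<in> live"
proof
  assume "a \<in> live"
  then obtain m where m: "m \<in> carrier M" "a \<odot>\<^bsub>M\<^esub> m \<noteq> \<zero>\<^bsub>M\<^esub>"
    by (auto simp: live_iff)
  then have "(s \<otimes> a) \<odot>\<^bsub>M\<^esub> m \<noteq> \<zero>\<^bsub>M\<^esub>"
    using smult_nonzero[OF assms(1), of "a \<odot>\<^bsub>M\<^esub> m"] assms by (simp add: smult_assoc1)
  then show "s \<otimes> a \<in> live"
    using assms m by (auto simp: live_iff)
qed (use live_factor assms in blast)

lemma lifts_frac: "rprim a \<Longrightarrow> u \<in> S \<Longrightarrow> t \<in> S \<Longrightarrow> lifts (frac (u \<otimes> a) t) a"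
  unfolding lifts_def by blast

lemma lifts_frac_one: "rprim a \<Longrightarrow> lifts (frac a \<one>) a"
  using lifts_frac[of a \<one> \<one>] rprimD(2)[of a] by simp

lemma mlifts_mfrac: "mprim n \<Longrightarrow> u \<in> S \<Longrightarrow> t \<in> S \<Longrightarrow> mlifts (mfrac (u \<odot>\<^bsub>M\<^esub> n) t) n"
  unfolding mlifts_def by blast

lemma mlifts_mfrac_one: "mprim n \<Longrightarrow> mlifts (mfrac n \<one>) n"
  using mlifts_mfrac[of n \<one> \<one>] mprimD(1)[of n] by simp

lemma rprim_factors:
  assumes "rprim (a \<otimes> b)" "a \<in> carrier R" "b \<in> carrier R"
  shows "rprim a" "rprim b"
proof -
  have live: "a \<in> live" "b \<in> live"
    using live_factor rprimD(1) assms by blast+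
  have "s \<in> Units R" if "s \<in> S" "c \<in> carrier R" "a = s \<otimes> c" for s c
    using that assms rprimD(3)[OF assms(1), of s "c \<otimes> b"] by (simp add: R.m_assoc)
  then show "rprim a"
    unfolding rprim_def using live by blast
  have "s \<in> Units R" if "s \<in> S" "c \<in> carrier R" "b = s \<otimes> c" for s c
    using that assms rprimD(3)[OF assms(1), of s "a \<otimes> c"] by (simp add: R.m_lcomm)
  then show "rprim b"
    unfolding rprim_def using live by blast
qed

text \<open>The two fractions differ only in their \<open>S\<close>-parts \<open>u / t\<close> and
  \<open>v / w\<close>, whose quotient is the factor \<open>z\<close>.\<close>

lemma lifts_same:
  assumes "lifts x a" "lifts y a"
  shows "\<exists>z\<in>carrier RS. x = z \<otimes>\<^bsub>RS\<^esub> y"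
proof -
  obtain u t where u: "u \<in> S" "t \<in> S" "x = frac (u \<otimes> a) t" "a \<in> carrier R"
    using assms(1) by (rule liftsE)
  obtain v w where v: "v \<in> S" "w \<in> S" "y = frac (v \<otimes> a) w"
    using assms(2) by (rule liftsE)
  have "x = frac (u \<otimes> w) (v \<otimes> t) \<otimes>\<^bsub>RS\<^esub> y"
    using u v by (simp add: loc_ring_mult frac_eq_iff R.m_ac)
  then show ?thesis
    using u v by (metis frac_carrier m_closed S_R)
qed

lemma mlifts_same:
  assumes "mlifts x n" "mlifts y n"
  shows "\<exists>z\<in>T. x = z \<odot>\<^bsub>MS\<^esub> y"
proof -
  obtain u t where u: "u \<in> S" "t \<in> S" "x = mfrac (u \<odot>\<^bsub>M\<^esub> n) t" "n \<in> carrier M"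
    using assms(1) by (rule mliftsE)
  obtain v w where v: "v \<in> S" "w \<in> S" "y = mfrac (v \<odot>\<^bsub>M\<^esub> n) w"
    using assms(2) by (rule mliftsE)
  have "x = frac (u \<otimes> w) (v \<otimes> t) \<odot>\<^bsub>MS\<^esub> y"
    using u v by (simp add: loc_frac_smult mfrac_eq_iff R.m_ac flip: smult_assoc1)
  moreover have "frac (u \<otimes> w) (v \<otimes> t) \<in> T"
    using u v S_subset by (auto simp: frac_in_T_iff)
  ultimately show ?thesis
    by blast
qed

end

text \<open>The assumption is the common core of two situations: \<open>S\<close>-factorizations of
  bounded length (\<open>compact_if_bounded\<close>), and the extra hypothesis of the
  presimplifiable case (\<open>compact_if_compactly_atomic\<close>).\<close>

locale compact_splitting_pair = splitting_pair +
  assumes compact: "a \<in> S' \<Longrightarrow> a \<in> live \<Longrightarrow> \<exists>s\<in>S. \<exists>b. rprim b \<and> a = s \<otimes> b"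
begin

lemma lifts_frac_ex:
  assumes "a \<in> S'" "a \<in> live" "t \<in> S"
  shows "\<exists>b\<in>S'. lifts (frac a t) b"
proof -
  obtain s b where s: "s \<in> S" "rprim b" "a = s \<otimes> b"
    using compact assms by blast
  then have "b \<in> S'"
    using saturatedD'[of s b] assms(1) rprimD(2) by blast
  then show ?thesis
    using lifts_frac[OF s(2,1) assms(3)] s(3) by blast
qed

text \<open>The nonzero product shows that the numerator is live, so \<open>compact\<close>
  applies.\<close>

lemma lifts_ex:
  assumes "x \<in> T" "y \<in> carrier MS" "x \<odot>\<^bsub>MS\<^esub> y \<noteq> \<zero>\<^bsub>MS\<^esub>"
  shows "\<exists>a\<in>S'. lifts x a"
proof -
  obtain a s where a: "a \<in> S'" "s \<in> S" "x = frac a s"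
    using assms(1) by (rule T_fracE)
  obtain n t where n: "n \<in> carrier M" "t \<in> S" "y = mfrac n t"
    using assms(2) by (rule mfrac_carrierE)
  have "a \<odot>\<^bsub>M\<^esub> n \<noteq> \<zero>\<^bsub>M\<^esub>"
    using assms(3) a n by (simp add: loc_frac_smult mfrac_zero_iff)
  then have "a \<in> live"
    using a n by (auto simp: live_iff)
  then show ?thesis
    using lifts_frac_ex a by blast
qed

text \<open>The numerators \<open>c\<close>, \<open>d\<close> are arbitrary, but
  cross-multiplication relates \<open>c d\<close> to \<open>a\<close> up to factors from
  \<open>S\<close>; being live and in \<open>S'\<close> passes to them, and \<open>compact\<close>
  yields primitive parts. Their product agrees with \<open>a\<close> up to a unit, which goes into
  the first factor.\<close>

lemma lifts_factor:
  assumes x: "lifts x a" "a \<in> S'" and eq: "x = z \<otimes>\<^bsub>RS\<^esub> y" and zy: "z \<in> carrier RS" "y \<in> carrier RS"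
  shows "\<exists>c b. lifts z c \<and> lifts y b \<and> a = c \<otimes> b"
proof -
  obtain u t where u: "u \<in> S" "t \<in> S" "x = frac (u \<otimes> a) t" "rprim a" "a \<in> carrier R"
    using x(1) by (rule liftsE)
  obtain c w where c: "c \<in> carrier R" "w \<in> S" "z = frac c w"
    using zy(1) by (rule frac_carrierE)
  obtain d v where d: "d \<in> carrier R" "v \<in> S" "y = frac d v"
    using zy(2) by (rule frac_carrierE)
  have cross: "t \<otimes> (c \<otimes> d) = (w \<otimes> v \<otimes> u) \<otimes> a"
    using eq u c d by (simp add: loc_ring_mult frac_eq_iff R.m_assoc)
  have "(w \<otimes> v \<otimes> u) \<otimes> a \<in> live" "(w \<otimes> v \<otimes> u) \<otimes> a \<in> S'"
    using live_scale_iff[of "w \<otimes> v \<otimes> u" a] rprimD(1)[OF u(4)] u c d x(2) S_subset by auto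
  then have cd: "c \<otimes> d \<in> live" "c \<otimes> d \<in> S'"
    using live_scale_iff[of t "c \<otimes> d"] saturatedD'[of t "c \<otimes> d"] cross u(2) c(1) d(1)
    by (metis R.m_closed S_R)+
  then have "c \<in> live" "d \<in> live" "c \<in> S'" "d \<in> S'"
    using live_factor saturatedD' c d by blast+
  then obtain s c' r d' where s: "s \<in> S" "rprim c'" "c = s \<otimes> c'" and r: "r \<in> S" "rprim d'" "d = r \<otimes> d'"
    using compact by metis
  have carr: "c' \<in> carrier R" "d' \<in> carrier R"
    using s r rprimD(2) by blast+
  have z: "lifts z c'" and y: "lifts y d'"
    using lifts_frac s r c d by blast+
  have "c \<otimes> d = (s \<otimes> r) \<otimes> (c' \<otimes> d')"
    using s r carr by (simp add: R.m_ac)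
  then have "c' \<otimes> d' \<in> live"
    using live_scale_iff[of "s \<otimes> r" "c' \<otimes> d'"] cd(1) s(1) r(1) carr by simp
  then have "lifts x (c' \<otimes> d')"
    using lifts_mult[OF z y] eq by simp
  then obtain e where e: "e \<in> Units R" "a = e \<otimes> (c' \<otimes> d')"
    using lifts_unique x(1) by blast
  then have a: "a = (e \<otimes> c') \<otimes> d'"
    using carr by (simp add: R.m_assoc R.Units_closed)
  then have "rprim (e \<otimes> c')"
    using rprim_factors(1)[of "e \<otimes> c'" d'] u(4) carr e(1) by (simp add: R.Units_closed)
  then show ?thesis
    using lifts_unit[OF z e(1)] y a by blast
qed

text \<open>A divisor \<open>c\<close> of the primitive \<open>a\<close> is primitive, so
  \<open>c / 1\<close> times \<open>y\<close> has primitive part \<open>a\<close> like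
  \<open>x\<close>, and \<open>lifts_same\<close> corrects the \<open>S\<close>-part. The other
  direction is \<open>lifts_factor\<close>.\<close>

lemma lifts_dvd_iff:
  assumes x: "lifts x a" "a \<in> S'" and y: "lifts y b" "b \<in> S'"
  shows "(\<exists>z\<in>carrier RS. x = z \<otimes>\<^bsub>RS\<^esub> y) \<longleftrightarrow> (\<exists>c\<in>carrier R. a = c \<otimes> b)"
proof
  assume "\<exists>z\<in>carrier RS. x = z \<otimes>\<^bsub>RS\<^esub> y"
  then obtain z where "z \<in> carrier RS" "x = z \<otimes>\<^bsub>RS\<^esub> y"
    by blast
  then obtain c b' where c: "lifts z c" "lifts y b'" "a = c \<otimes> b'"
    using lifts_factor[OF x] lifts_carrier[OF y(1)] by blast
  obtain e where e: "e \<in> Units R" "b' = e \<otimes> b"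
    using lifts_unique[OF y(1) c(2)] by blast
  have carr: "c \<in> carrier R" "b \<in> carrier R"
    using c(1) y(2) by (auto elim: liftsE)
  then have "a = (c \<otimes> e) \<otimes> b" "c \<otimes> e \<in> carrier R"
    using c(3) e by (simp_all add: R.m_assoc R.Units_closed)
  then show "\<exists>c\<in>carrier R. a = c \<otimes> b"
    by blast
next
  assume "\<exists>c\<in>carrier R. a = c \<otimes> b"
  then obtain c where c: "c \<in> carrier R" "a = c \<otimes> b"
    by blast
  have a: "rprim a" "a \<in> live"
    using x(1) rprimD(1) unfolding lifts_def by blast+
  then have "rprim c"
    using rprim_factors(1)[of c b] c y(2) by simp
  then have lc: "lifts (frac c \<one>) c"
    by (rule lifts_frac_one)
  then have "lifts (frac c \<one> \<otimes>\<^bsub>RS\<^esub> y) a"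
    using lifts_mult[OF lc y(1)] a(2) c(2) by simp
  then obtain z where z: "z \<in> carrier RS" "x = z \<otimes>\<^bsub>RS\<^esub> (frac c \<one> \<otimes>\<^bsub>RS\<^esub> y)"
    using lifts_same x(1) by blast
  then have "x = (z \<otimes>\<^bsub>RS\<^esub> frac c \<one>) \<otimes>\<^bsub>RS\<^esub> y" "z \<otimes>\<^bsub>RS\<^esub> frac c \<one> \<in> carrier RS"
    using lifts_carrier[OF lc] lifts_carrier[OF y(1)] by (simp_all add: RS.R.m_assoc)
  then show "\<exists>z\<in>carrier RS. x = z \<otimes>\<^bsub>RS\<^esub> y"
    by blast
qed

lemma lifts_sim_iff:
  assumes x: "lifts x a" "a \<in> S'" and y: "lifts y b" "b \<in> S'"
  shows "ring_sim RS x y \<longleftrightarrow> ring_sim R a b"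
proof -
  have "ring_sim RS x y \<longleftrightarrow>
      (\<exists>z\<in>carrier RS. x = z \<otimes>\<^bsub>RS\<^esub> y) \<and> (\<exists>z\<in>carrier RS. y = z \<otimes>\<^bsub>RS\<^esub> x)"
    unfolding S_sim_def RS.self_module_simps by blast
  also have "\<dots> \<longleftrightarrow> ring_sim R a b"
    unfolding lifts_dvd_iff[OF x y] lifts_dvd_iff[OF y x] S_sim_def self_module_simps by blast
  finally show ?thesis .
qed

lemma mlifts_dvd_iff:
  assumes y: "mlifts y n" and y': "mlifts y' n'"
  shows "(\<exists>x\<in>T. y = x \<odot>\<^bsub>MS\<^esub> y') \<longleftrightarrow> (\<exists>c\<in>S'. n = c \<odot>\<^bsub>M\<^esub> n')"
proof
  assume "\<exists>x\<in>T. y = x \<odot>\<^bsub>MS\<^esub> y'"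
  then obtain x where x: "x \<in> T" "y = x \<odot>\<^bsub>MS\<^esub> y'"
    by blast
  then have nz: "x \<odot>\<^bsub>MS\<^esub> y' \<noteq> \<zero>\<^bsub>MS\<^esub>"
    using mlifts_nonzero[OF y] by simp
  then obtain c where c: "c \<in> S'" "lifts x c"
    using lifts_ex x(1) mlifts_carrier[OF y'] by blast
  have "mlifts y (c \<odot>\<^bsub>M\<^esub> n')"
    using lifts_smult[OF c(2) y' nz] x(2) by simp
  then obtain e where e: "e \<in> Units R" "n = e \<odot>\<^bsub>M\<^esub> (c \<odot>\<^bsub>M\<^esub> n')"
    using mlifts_unique y by blast
  have "n' \<in> carrier M"
    using y' by (rule mliftsE)
  then have "n = (e \<otimes> c) \<odot>\<^bsub>M\<^esub> n'" "e \<otimes> c \<in> S'"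
    using e c(1) Units_subset' by (auto simp: smult_assoc1)
  then show "\<exists>c\<in>S'. n = c \<odot>\<^bsub>M\<^esub> n'"
    by blast
next
  assume "\<exists>c\<in>S'. n = c \<odot>\<^bsub>M\<^esub> n'"
  then obtain c where c: "c \<in> S'" "n = c \<odot>\<^bsub>M\<^esub> n'"
    by blast
  obtain v w where v: "v \<in> S" "w \<in> S" "y' = mfrac (v \<odot>\<^bsub>M\<^esub> n') w" "n' \<in> carrier M"
    using y' by (rule mliftsE)
  have "mprim n"
    using y by (rule mliftsE)
  have "c \<odot>\<^bsub>M\<^esub> (v \<odot>\<^bsub>M\<^esub> n') = v \<odot>\<^bsub>M\<^esub> n"
    using c v by (simp add: smult_swap[of c v])
  then have "frac c \<one> \<odot>\<^bsub>MS\<^esub> y' = mfrac (v \<odot>\<^bsub>M\<^esub> n) w"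
    using c(1) v by (simp add: loc_frac_smult)
  then have "mlifts (frac c \<one> \<odot>\<^bsub>MS\<^esub> y') n"
    using mlifts_mfrac[OF \<open>mprim n\<close> v(1,2)] by simp
  then obtain z where z: "z \<in> T" "y = z \<odot>\<^bsub>MS\<^esub> (frac c \<one> \<odot>\<^bsub>MS\<^esub> y')"
    using mlifts_same y by blast
  have fc: "frac c \<one> \<in> T"
    using c(1) by (simp add: frac_in_T_iff)
  then have "y = (z \<otimes>\<^bsub>RS\<^esub> frac c \<one>) \<odot>\<^bsub>MS\<^esub> y'"
    using z mlifts_carrier[OF y'] RS.S_R by (simp add: RS.smult_assoc1)
  then show "\<exists>x\<in>T. y = x \<odot>\<^bsub>MS\<^esub> y'"
    using z(1) fc RS.m_closed by blast
qed

lemma mlifts_sim_iff: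
  assumes y: "mlifts y n" and y': "mlifts y' n'"
  shows "S_sim MS T y y' \<longleftrightarrow> S_sim M S' n n'"
proof -
  have "S_sim MS T y y' \<longleftrightarrow> (\<exists>x\<in>T. y = x \<odot>\<^bsub>MS\<^esub> y') \<and> (\<exists>x\<in>T. y' = x \<odot>\<^bsub>MS\<^esub> y)"
    unfolding S_sim_def by blast
  also have "\<dots> \<longleftrightarrow> S_sim M S' n n'"
    unfolding mlifts_dvd_iff[OF y y'] mlifts_dvd_iff[OF y' y] S_sim_def by blast
  finally show ?thesis .
qed

lemma lifts_irred_iff:
  assumes x: "lifts x a" "a \<in> S'"
  shows "irred RS x \<longleftrightarrow> irred R a"
proof
  obtain u t where u: "u \<in> S" "t \<in> S" "x = frac (u \<otimes> a) t" "rprim a" "a \<in> carrier R"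
    using x(1) by (rule liftsE)
  assume irr: "irred RS x"
  have "ring_sim R a b \<or> ring_sim R a c"
    if bc: "b \<in> carrier R" "c \<in> carrier R" "a = b \<otimes> c" for b c
  proof -
    have prim: "rprim b" "rprim c"
      using rprim_factors[of b c] u(4) bc by simp_all
    have S': "b \<in> S'" "c \<in> S'"
      using saturatedD'[of b c] x(2) bc by simp_all
    \<comment> \<open>The \<open>S\<close>-part \<open>u / t\<close> of \<open>x\<close> goes into
      the first factor, so that the product is \<open>x\<close> itself.\<close>
    have "x = frac (u \<otimes> b) t \<otimes>\<^bsub>RS\<^esub> frac c \<one>"
      using u bc by (simp add: loc_ring_mult R.m_assoc)
    then have "ring_sim RS x (frac (u \<otimes> b) t) \<or> ring_sim RS x (frac c \<one>)"
      using irr u bc unfolding irred_def by simp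
    then show ?thesis
      using lifts_sim_iff[OF x lifts_frac S'(1)] lifts_sim_iff[OF x lifts_frac_one S'(2)] prim u(1,2)
      by blast
  qed
  moreover have "a \<notin> Units R"
    using irr lifts_Units_iff[OF x(1)] unfolding irred_def by blast
  ultimately show "irred R a"
    unfolding irred_def using u(5) by blast
next
  assume irr: "irred R a"
  have "ring_sim RS x z \<or> ring_sim RS x y"
    if zy: "z \<in> carrier RS" "y \<in> carrier RS" "x = z \<otimes>\<^bsub>RS\<^esub> y" for z y
  proof -
    obtain c b where cb: "lifts z c" "lifts y b" "a = c \<otimes> b"
      using lifts_factor[OF x zy(3,1,2)] by blast
    then have carr: "c \<in> carrier R" "b \<in> carrier R"
      by (auto elim: liftsE)
    then have "c \<in> S'" "b \<in> S'"
      using saturatedD'[of c b] x(2) cb(3) by simp_all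
    moreover have "ring_sim R a c \<or> ring_sim R a b"
      using irr carr cb(3) unfolding irred_def by blast
    ultimately show ?thesis
      using lifts_sim_iff[OF x cb(1)] lifts_sim_iff[OF x cb(2)] by blast
  qed
  moreover have "x \<notin> Units RS"
    using irr lifts_Units_iff[OF x(1)] unfolding irred_def by blast
  ultimately show "irred RS x"
    unfolding irred_def using lifts_carrier[OF x(1)] by blast
qed

text \<open>A divisor of a primitive element is primitive, so \<open>n'\<close> is the primitive
  part of \<open>n' / 1\<close>; conversely a divisor \<open>y'\<close> of the nonzero
  \<open>y\<close> is nonzero and has a primitive part. Divisibility and \<open>S_sim\<close> agree
  on both levels.\<close>

lemma mlifts_S_primitive_iff:
  assumes y: "mlifts y n"
  shows "S_primitive MS T y \<longleftrightarrow> S_primitive M S' n"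
proof
  obtain u t where u: "u \<in> S" "t \<in> S" "y = mfrac (u \<odot>\<^bsub>M\<^esub> n) t" "mprim n" "n \<in> carrier M"
    using y by (rule mliftsE)
  assume prim: "S_primitive MS T y"
  have "S_sim M S' n' n" if c: "c \<in> S'" and n': "n' \<in> carrier M" and eq: "n = c \<odot>\<^bsub>M\<^esub> n'" for c n'
  proof -
    have "mprim n'"
      using mprim_smultD(2)[of c n'] c n' eq u(4) by simp
    then have l: "mlifts (mfrac n' \<one>) n'"
      by (rule mlifts_mfrac_one)
    have "y = frac (u \<otimes> c) t \<odot>\<^bsub>MS\<^esub> mfrac n' \<one>"
      using u c n' eq by (simp add: loc_frac_smult smult_assoc1)
    moreover have "frac (u \<otimes> c) t \<in> T"
      using u c S_subset by (auto simp: frac_in_T_iff)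
    ultimately have "S_sim MS T (mfrac n' \<one>) y"
      using prim mlifts_carrier[OF l] unfolding S_primitive_def by blast
    then show ?thesis
      using mlifts_sim_iff[OF l y] by blast
  qed
  then show "S_primitive M S' n"
    unfolding S_primitive_def using u(5) by blast
next
  assume prim: "S_primitive M S' n"
  have "S_sim MS T y' y" if x: "x \<in> T" and y': "y' \<in> carrier MS" and eq: "y = x \<odot>\<^bsub>MS\<^esub> y'" for x y'
  proof -
    have "y' \<noteq> \<zero>\<^bsub>MS\<^esub>"
    proof
      assume "y' = \<zero>\<^bsub>MS\<^esub>"
      then have "y = \<zero>\<^bsub>MS\<^esub>"
        using eq x RS.S_R[OF x] by simp
      then show False
        using mlifts_nonzero[OF y] by blast
    qed
    then obtain n' where n': "mlifts y' n'"
      using mlifts_ex y' by blast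
    have "\<exists>c\<in>S'. n = c \<odot>\<^bsub>M\<^esub> n'"
      using mlifts_dvd_iff[OF y n'] x eq by blast
    then have "S_sim M S' n' n"
      using prim mprimD(1) n' unfolding S_primitive_def mlifts_def by blast
    then show ?thesis
      using mlifts_sim_iff[OF n' y] by blast
  qed
  then show "S_primitive MS T y"
    unfolding S_primitive_def using mlifts_carrier[OF y] by blast
qed

end

section \<open>Lifting factorizations from the localization\<close>

text \<open>On related pairs \<open>g a\<close> is a function \<open>h\<close> of
  \<open>f x\<close>, so the multiset of values of \<open>g\<close> is the image under
  \<open>h\<close> of that of \<open>f\<close>. This carries equality of classes of scalars between
  \<open>R\<close> and the localization.\<close>

lemma mset_map_eq_transfer:
  assumes "list_all2 P xs as" "list_all2 P ys bs"
    and "\<And>x a y b. P x a \<Longrightarrow> P y b \<Longrightarrow> f x = f y \<Longrightarrow> g a = g b"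
    and "mset (map f xs) = mset (map f ys)"
  shows "mset (map g as) = mset (map g bs)"
proof -
  define h where "h z = g (SOME a. \<exists>x. P x a \<and> f x = z)" for z
  have h: "h (f x) = g a" if "P x a" for x a
  proof -
    define b where "b = (SOME b. \<exists>y. P y b \<and> f y = f x)"
    have "\<exists>y. P y b \<and> f y = f x"
      unfolding b_def by (rule someI[of _ a]) (use that in blast)
    then obtain y where "P y b" "f y = f x"
      by blast
    then show ?thesis
      using assms(3)[OF _ that] by (simp add: h_def b_def)
  qed
  have "mset (map g as) = image_mset h (mset (map f xs))" if "list_all2 P xs as" for xs as
    using that by (induction rule: list_all2_induct) (simp_all add: h)
  then show ?thesis
    using assms(1,2,4) by metis
qed

section \<open>Bounded factorization for \<open>S'\<close>, \<open>S\<close> and the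
  localization\<close>

context splitting_pair
begin

lemma bounded_split_imp:
  assumes "bounded_factorization R M S'"
  shows "bounded_factorization R M S"
proof -
  have "S_factorizations R M S m \<subseteq> S_factorizations R M S' m" for m
    using S_subset by (auto simp: S_factorizations_def)
  then show ?thesis
    using assms unfolding bounded_factorization_def by blast
qed

lemma foldr_frac_smult:
  assumes "set as \<subseteq> carrier R" "n \<in> carrier M" "t \<in> S"
  shows "foldr (smult MS) (map (\<lambda>a. frac a \<one>) as) (mfrac n t) = mfrac (foldr (smult M) as n) t"
  using assms(1)
proof (induction as)
  case (Cons a as)
  then show ?case
    using assms(2,3) by (simp add: loc_frac_smult)
qed simp

text \<open>The factors in \<open>S\<close> are counted over \<open>S\<close> in \<open>M\<close>;
  those outside \<open>S\<close> stay nonunits in the localization and are counted there. The bound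
  is the sum.\<close>

lemma bounded_join:
  assumes bS: "bounded_factorization R M S" and bT: "bounded_factorization RS MS T"
  shows "bounded_factorization R M S'"
  unfolding bounded_factorization_def
proof
  fix m assume m: "m \<in> carrier M - {\<zero>\<^bsub>M\<^esub>}"
  then have "mfrac m \<one> \<in> carrier MS - {\<zero>\<^bsub>MS\<^esub>}"
    by (simp add: mfrac_zero_iff)
  then obtain K where K: "\<forall>(us, y)\<in>S_factorizations RS MS T (mfrac m \<one>). length us \<le> K"
    using bT unfolding bounded_factorization_def by blast
  obtain N where N: "\<forall>(ss, n)\<in>S_factorizations R M S m. length ss \<le> N"
    using bS m unfolding bounded_factorization_def by blast
  have "length ss \<le> N + K" if f: "(ss, n) \<in> S_factorizations R M S' m" for ss n
  proof -
    let ?A = "filter (\<lambda>s. s \<in> S) ss" and ?B = "filter (\<lambda>s. s \<notin> S) ss"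
    have ss: "set ss \<subseteq> S' - Units R" "n \<in> carrier M" "m = foldr (smult M) ss n"
      using f by (simp_all add: S'.S_factorizations_iff)
    then have carr: "set ss \<subseteq> carrier R" "set ?A \<subseteq> carrier R" "set ?B \<subseteq> carrier R"
      by auto
    have "m = foldr (smult M) ?A (foldr (smult M) ?B n)"
      using foldr_smult_partition[OF carr(1) ss(2), of "\<lambda>s. s \<in> S"] ss(3) by simp
    moreover have "set ?A \<subseteq> S - Units R"
      using ss(1) by auto
    ultimately have "(?A, foldr (smult M) ?B n) \<in> S_factorizations R M S m"
      unfolding S_factorizations_iff using foldr_smult_closed[OF carr(3) ss(2)] by blast
    then have "length ?A \<le> N"
      using N by blast
    moreover
    let ?C = "map (\<lambda>a. frac a \<one>) ?B" and ?y = "mfrac (foldr (smult M) ?A n) \<one>"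
    \<comment> \<open>The same partition in the other order, with the factors in \<open>S\<close>
      moved into the module element.\<close>
    have "m = foldr (smult M) ?B (foldr (smult M) ?A n)"
      using foldr_smult_partition[OF carr(1) ss(2), of "\<lambda>s. s \<notin> S"] ss(3) by simp
    then have "mfrac m \<one> = foldr (smult MS) ?C ?y"
      using foldr_frac_smult[OF carr(3)] foldr_smult_closed[OF carr(2) ss(2)] by simp
    moreover have "set ?C \<subseteq> T - Units RS"
      using ss(1) carr(1) by (auto simp: frac_in_T_iff frac_Units_iff)
    moreover have "?y \<in> carrier MS"
      using foldr_smult_closed[OF carr(2) ss(2)] by simp
    ultimately have "(?C, ?y) \<in> S_factorizations RS MS T (mfrac m \<one>)"
      unfolding RS.S_factorizations_iff by blast
    then have "length ?C \<le> K"
      using K by blast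
    moreover have "length ss = length ?A + length ?B"
      by (rule sum_length_filter_compl[symmetric])
    ultimately show ?thesis
      using \<open>length ?A \<le> N\<close> by simp
  qed
  then show "\<exists>N. \<forall>(ss, n)\<in>S_factorizations R M S' m. length ss \<le> N"
    by blast
qed

end

section \<open>Factorizations of a fraction and of its primitive part\<close>

context compact_splitting_pair
begin

abbreviation lifts_list :: "('a \<times> 'a) set list \<Rightarrow> 'a list \<Rightarrow> bool"
  where "lifts_list \<equiv> list_all2 (\<lambda>x a. lifts x a \<and> a \<in> S')"

lemma lifts_list_carrier: "lifts_list us as \<Longrightarrow> set us \<subseteq> carrier RS \<and> set as \<subseteq> carrier R"
  by (induction rule: list_all2_induct) (auto simp: lifts_carrier)

lemma lifts_list_nonunits:
  "lifts_list us as \<Longrightarrow> set us \<subseteq> T - Units RS \<longleftrightarrow> set as \<subseteq> S' - Units R"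
  by (induction rule: list_all2_induct) (auto simp: lifts_in_T_iff lifts_Units_iff)

lemma lifts_list_irred:
  "lifts_list us as \<Longrightarrow> (\<forall>x\<in>set us. irred RS x) \<longleftrightarrow> (\<forall>a\<in>set as. irred R a)"
  by (induction rule: list_all2_induct) (auto simp: lifts_irred_iff)

text \<open>In a nonzero product each scalar acts nontrivially on the nonzero rest, so
  \<open>lifts_ex\<close> and \<open>lifts_smult\<close> apply at every step of the
  induction.\<close>

lemma lifts_list_ex:
  assumes "set us \<subseteq> T" "y \<in> carrier MS" "foldr (smult MS) us y \<noteq> \<zero>\<^bsub>MS\<^esub>"
  shows "\<exists>as n. lifts_list us as \<and> mlifts y n \<and>
    mlifts (foldr (smult MS) us y) (foldr (smult M) as n)"
  using assms(1,3)
proof (induction us)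
  case Nil
  then obtain n where "mlifts y n"
    using mlifts_ex[OF assms(2)] unfolding foldr_Nil id_apply by blast
  then show ?case
    by (intro exI[of _ "[]"] exI[of _ n]) simp
next
  case (Cons x us)
  have T: "x \<in> T" "set us \<subseteq> T"
    using Cons.prems by auto
  then have carr: "x \<in> carrier RS" "set us \<subseteq> carrier RS"
    using RS.S_R by blast+
  have nz: "x \<odot>\<^bsub>MS\<^esub> foldr (smult MS) us y \<noteq> \<zero>\<^bsub>MS\<^esub>"
    using Cons.prems by simp
  have "foldr (smult MS) us y \<noteq> \<zero>\<^bsub>MS\<^esub>"
  proof
    assume "foldr (smult MS) us y = \<zero>\<^bsub>MS\<^esub>"
    then show False
      using nz RS.smult_r_null[OF carr(1)] by simp
  qed
  then obtain as n where as: "lifts_list us as" "mlifts y n"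
      "mlifts (foldr (smult MS) us y) (foldr (smult M) as n)"
    using Cons.IH T by blast
  obtain a where a: "a \<in> S'" "lifts x a"
    using lifts_ex[OF T(1) RS.foldr_smult_closed[OF carr(2) assms(2)] nz] by blast
  have "mlifts (foldr (smult MS) (x # us) y) (foldr (smult M) (a # as) n)"
    using lifts_smult[OF a(2) as(3) nz] by simp
  moreover have "lifts_list (x # us) (a # as)"
    using a as(1) by simp
  ultimately show ?case
    using as(2) by (intro exI[of _ "a # as"] exI[of _ n]) simp
qed

text \<open>The product of the primitive parts is again a primitive part of \<open>x\<close>, so it
  equals \<open>p\<close> up to a unit, which is absorbed by the module element.\<close>

lemma lift_factorization:
  assumes x: "mlifts x p" and f: "(us, y) \<in> S_factorizations RS MS T x"
  shows "\<exists>as n. lifts_list us as \<and> mlifts y n \<and> (as, n) \<in> S_factorizations R M S' p"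
proof -
  have us: "set us \<subseteq> T - Units RS" "y \<in> carrier MS" "x = foldr (smult MS) us y"
    using f by (simp_all add: RS.S_factorizations_iff)
  have p: "mprim p"
    using x by (rule mliftsE)
  obtain as n where as: "lifts_list us as" "mlifts y n" "mlifts x (foldr (smult M) as n)"
    using lifts_list_ex[of us y] us mlifts_nonzero[OF x] by blast
  have asR: "set as \<subseteq> carrier R" and n: "n \<in> carrier M"
    using lifts_list_carrier as by (auto elim: mliftsE)
  obtain e where e: "e \<in> Units R" "p = e \<odot>\<^bsub>M\<^esub> foldr (smult M) as n"
    using mlifts_unique[OF as(3) x] by blast
  then have eq: "p = foldr (smult M) as (e \<odot>\<^bsub>M\<^esub> n)"
    using foldr_smult_smult asR n by (simp add: R.Units_closed)
  then have "mprim (e \<odot>\<^bsub>M\<^esub> n)"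
    using mprim_foldr_smultD[of as "e \<odot>\<^bsub>M\<^esub> n"] p asR n e(1) by (simp add: R.Units_closed)
  then have "mlifts y (e \<odot>\<^bsub>M\<^esub> n)"
    using mlifts_unit as(2) e(1) by blast
  moreover have "(as, e \<odot>\<^bsub>M\<^esub> n) \<in> S_factorizations R M S' p"
    unfolding S'.S_factorizations_iff using lifts_list_nonunits[OF as(1)] us(1) eq n e(1)
    by (simp add: R.Units_closed)
  ultimately show ?thesis
    using as(1) by blast
qed

lemma localize_factorization:
  assumes x: "mlifts x p" and f: "(as, n) \<in> S_factorizations R M S' p"
  shows "\<exists>us y. lifts_list us as \<and> mlifts y n \<and> (us, y) \<in> S_factorizations RS MS T x"
proof -
  have as: "set as \<subseteq> S' - Units R" "n \<in> carrier M" "p = foldr (smult M) as n"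
    using f by (simp_all add: S'.S_factorizations_iff)
  then have asR: "set as \<subseteq> carrier R"
    by auto
  obtain u t where u: "u \<in> S" "t \<in> S" "x = mfrac (u \<odot>\<^bsub>M\<^esub> p) t" "mprim p"
    using x by (rule mliftsE)
  have prim: "\<forall>a\<in>set as. rprim a" "mprim n"
    using mprim_foldr_smultD[of as n] u(4) as asR by simp_all
  \<comment> \<open>Scalars become fractions \<open>a / 1\<close>, while the \<open>S\<close>-part
    \<open>u / t\<close> of \<open>x\<close> is put into the module element.\<close>
  let ?us = "map (\<lambda>a. frac a \<one>) as" and ?y = "mfrac (u \<odot>\<^bsub>M\<^esub> n) t"
  have "lifts_list ?us as"
    unfolding list_all2_map1 using prim(1) as(1) by (auto simp: list_all2_same lifts_frac_one)
  moreover have "mlifts ?y n"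
    using mlifts_mfrac prim(2) u(1,2) by blast
  moreover have "x = foldr (smult MS) ?us ?y"
    using foldr_frac_smult[OF asR, of "u \<odot>\<^bsub>M\<^esub> n" t] foldr_smult_smult[OF asR, of u n] u as(2,3)
    by simp
  ultimately show ?thesis
    unfolding RS.S_factorizations_iff using lifts_list_nonunits as(1) mlifts_carrier by blast
qed

lemma lifts_atomic_iff:
  assumes "lifts_list us as" "mlifts y n"
    and "(us, y) \<in> S_factorizations RS MS T x" "(as, n) \<in> S_factorizations R M S' p"
  shows "(us, y) \<in> S_atomic_factorizations RS MS T x \<longleftrightarrow> (as, n) \<in> S_atomic_factorizations R M S' p"
  unfolding S_atomic_factorizations_def
  using assms lifts_list_irred[OF assms(1)] mlifts_S_primitive_iff[OF assms(2)] by simp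

lemma lift_atomic_factorization:
  assumes "mlifts x p" "(us, y) \<in> S_atomic_factorizations RS MS T x"
  shows "\<exists>as n. lifts_list us as \<and> mlifts y n \<and> (as, n) \<in> S_atomic_factorizations R M S' p"
proof -
  have f: "(us, y) \<in> S_factorizations RS MS T x"
    using assms(2) by (simp add: S_atomic_factorizations_def)
  then obtain as n where as: "lifts_list us as" "mlifts y n" "(as, n) \<in> S_factorizations R M S' p"
    using lift_factorization[OF assms(1)] by blast
  then show ?thesis
    using lifts_atomic_iff[OF as(1,2) f as(3)] assms(2) by blast
qed

lemma localize_atomic_factorization:
  assumes "mlifts x p" "(as, n) \<in> S_atomic_factorizations R M S' p"
  shows "\<exists>us y. lifts_list us as \<and> mlifts y n \<and> (us, y) \<in> S_atomic_factorizations RS MS T x"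
proof -
  have f: "(as, n) \<in> S_factorizations R M S' p"
    using assms(2) by (simp add: S_atomic_factorizations_def)
  then obtain us y where us: "lifts_list us as" "mlifts y n" "(us, y) \<in> S_factorizations RS MS T x"
    using localize_factorization[OF assms(1)] by blast
  then show ?thesis
    using lifts_atomic_iff[OF us f] assms(2) by blast
qed

lemma lifts_fact_type_iff:
  assumes us: "lifts_list us as" "mlifts y n" and vs: "lifts_list vs bs" "mlifts z q"
  shows "fact_type l RS MS T (us, y) = fact_type l RS MS T (vs, z) \<longleftrightarrow>
    fact_type l R M S' (as, n) = fact_type l R M S' (bs, q)"
proof -
  have cls: "ring_class RS x = ring_class RS x' \<longleftrightarrow> ring_class R a = ring_class R a'"
    if "lifts x a \<and> a \<in> S'" "lifts x' a' \<and> a' \<in> S'" for x a x' a'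
  proof -
    have "x \<in> carrier RS" "x' \<in> carrier RS" "a \<in> carrier R" "a' \<in> carrier R"
      using that lifts_carrier by auto
    then show ?thesis
      using that lifts_sim_iff[of x a x' a'] by (simp add: RS.ring_class_eq_iff ring_class_eq_iff)
  qed
  \<comment> \<open>The converse relation lets \<open>mset_map_eq_transfer\<close> run from
    \<open>R\<close> to the localization.\<close>
  have flip: "list_all2 (\<lambda>a x. lifts x a \<and> a \<in> S') as us" "list_all2 (\<lambda>a x. lifts x a \<and> a \<in> S') bs vs"
    using us(1) vs(1) by (simp_all add: list_all2_conv_all_nth)
  have "mset (map (ring_class RS) us) = mset (map (ring_class RS) vs) \<longleftrightarrow>
      mset (map (ring_class R) as) = mset (map (ring_class R) bs)"
  proof
    show "mset (map (ring_class R) as) = mset (map (ring_class R) bs)"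
      if "mset (map (ring_class RS) us) = mset (map (ring_class RS) vs)"
      by (rule mset_map_eq_transfer[OF us(1) vs(1) _ that]) (use cls in blast)
    show "mset (map (ring_class RS) us) = mset (map (ring_class RS) vs)"
      if "mset (map (ring_class R) as) = mset (map (ring_class R) bs)"
      by (rule mset_map_eq_transfer[OF flip _ that]) (use cls in blast)
  qed
  moreover have "length us = length as" "length vs = length bs"
    using us vs by (simp_all add: list_all2_lengthD)
  moreover have "sim_class MS T y = sim_class MS T z \<longleftrightarrow> sim_class M S' n = sim_class M S' q"
    using us(2) vs(2) mlifts_sim_iff mlifts_carrier
    by (simp add: RS.sim_class_eq_iff S'.sim_class_eq_iff mlifts_def mprimD(1))
  ultimately show ?thesis
    by (simp add: fact_type_def)
qed

text \<open>Primitive parts are determined only up to units, and many fractions share one, so the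
  correspondence of factorizations is a relation \<open>r\<close>. Choice functions in both
  directions suffice, since \<open>r\<close> preserves and reflects equality of types.\<close>

lemma few_types_localization:
  "few_types k l RS MS T (carrier MS - {\<zero>\<^bsub>MS\<^esub>}) \<longleftrightarrow> few_types k l R M S' {p. mprim p}"
proof -
  let ?F = "S_atomic_factorizations R M S'" and ?G = "S_atomic_factorizations RS MS T"
  define r where "r g f \<longleftrightarrow> lifts_list (fst g) (fst f) \<and> mlifts (snd g) (snd f)" for g f
  have types: "fact_type l RS MS T g = fact_type l RS MS T g' \<longleftrightarrow>
      fact_type l R M S' f = fact_type l R M S' f'" if "r g f" "r g' f'" for g f g' f'
    using that lifts_fact_type_iff[of "fst g" "fst f" "snd g" "snd f" "fst g'" "fst f'" "snd g'" "snd f'"]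
    unfolding r_def prod.collapse by blast
  have eq: "(?G x \<noteq> {} \<and> few k (fact_type l RS MS T ` ?G x)) \<longleftrightarrow>
      (?F p \<noteq> {} \<and> few k (fact_type l R M S' ` ?F p))" if x: "mlifts x p" for x p
  proof -
    have up: "\<forall>g\<in>?G x. \<exists>f. f \<in> ?F p \<and> r g f"
    proof
      fix g assume "g \<in> ?G x"
      then obtain as n where "lifts_list (fst g) as" "mlifts (snd g) n" "(as, n) \<in> ?F p"
        using lift_atomic_factorization[OF x, of "fst g" "snd g"] by auto
      then show "\<exists>f. f \<in> ?F p \<and> r g f"
        unfolding r_def by (intro exI[of _ "(as, n)"]) simp
    qed
    have down: "\<forall>f\<in>?F p. \<exists>g. g \<in> ?G x \<and> r g f"
    proof
      fix f assume "f \<in> ?F p"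
      then obtain us y where "lifts_list us (fst f)" "mlifts y (snd f)" "(us, y) \<in> ?G x"
        using localize_atomic_factorization[OF x, of "fst f" "snd f"] by auto
      then show "\<exists>g. g \<in> ?G x \<and> r g f"
        unfolding r_def by (intro exI[of _ "(us, y)"]) simp
    qed
    obtain h where h: "\<forall>g\<in>?G x. h g \<in> ?F p \<and> r g (h g)"
      using bchoice[OF up] by blast
    obtain h' where h': "\<forall>f\<in>?F p. h' f \<in> ?G x \<and> r (h' f) f"
      using bchoice[OF down] by blast
    have "few k (fact_type l RS MS T ` ?G x)" if "few k (fact_type l R M S' ` ?F p)"
      using that
    proof (rule few_image_transfer)
      show "h ` ?G x \<subseteq> ?F p"
        using h by blast
      fix g g' assume "g \<in> ?G x" "g' \<in> ?G x" and t: "fact_type l R M S' (h g) = fact_type l R M S' (h g')"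
      then have "r g (h g)" "r g' (h g')"
        using h by blast+
      then show "fact_type l RS MS T g = fact_type l RS MS T g'"
        using types t by blast
    qed
    moreover have "few k (fact_type l R M S' ` ?F p)" if "few k (fact_type l RS MS T ` ?G x)"
      using that
    proof (rule few_image_transfer)
      show "h' ` ?F p \<subseteq> ?G x"
        using h' by blast
      fix f f' assume "f \<in> ?F p" "f' \<in> ?F p" and t: "fact_type l RS MS T (h' f) = fact_type l RS MS T (h' f')"
      then have "r (h' f) f" "r (h' f') f'"
        using h' by blast+
      then show "fact_type l R M S' f = fact_type l R M S' f'"
        using types t by blast
    qed
    moreover have "?G x \<noteq> {} \<longleftrightarrow> ?F p \<noteq> {}"
      using up down by blast
    ultimately show ?thesis
      by blast
  qed
  show ?thesis
  proof
    assume L: "few_types k l RS MS T (carrier MS - {\<zero>\<^bsub>MS\<^esub>})"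
    show "few_types k l R M S' {p. mprim p}"
      unfolding few_types_def
    proof
      fix p assume "p \<in> {p. mprim p}"
      then have x: "mlifts (mfrac p \<one>) p"
        using mlifts_mfrac_one by blast
      then have "mfrac p \<one> \<in> carrier MS - {\<zero>\<^bsub>MS\<^esub>}"
        using mlifts_carrier mlifts_nonzero by blast
      then show "?F p \<noteq> {} \<and> few k (fact_type l R M S' ` ?F p)"
        using L eq[OF x] unfolding few_types_def by blast
    qed
  next
    assume R: "few_types k l R M S' {p. mprim p}"
    show "few_types k l RS MS T (carrier MS - {\<zero>\<^bsub>MS\<^esub>})"
      unfolding few_types_def
    proof
      fix x assume "x \<in> carrier MS - {\<zero>\<^bsub>MS\<^esub>}"
      then obtain p where p: "mlifts x p"
        using mlifts_ex by blast
      then have "mprim p"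
        by (rule mliftsE)
      then show "?G x \<noteq> {} \<and> few k (fact_type l RS MS T ` ?G x)"
        using R eq[OF p] unfolding few_types_def by blast
    qed
  qed
qed

lemma bounded_localization:
  assumes "bounded_factorization R M S'"
  shows "bounded_factorization RS MS T"
  unfolding bounded_factorization_def
proof
  fix x assume "x \<in> carrier MS - {\<zero>\<^bsub>MS\<^esub>}"
  then obtain p where p: "mlifts x p"
    using mlifts_ex by blast
  then have "mprim p"
    by (rule mliftsE)
  then obtain N where N: "\<forall>(ss, n)\<in>S_factorizations R M S' p. length ss \<le> N"
    using assms mprimD unfolding bounded_factorization_def by blast
  have "length us \<le> N" if "(us, y) \<in> S_factorizations RS MS T x" for us y
    using lift_factorization[OF p that] N list_all2_lengthD by fastforce
  then show "\<exists>N. \<forall>(us, y)\<in>S_factorizations RS MS T x. length us \<le> N"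
    by blast
qed

text \<open>From \<open>x y = y\<close> the primitive parts satisfy \<open>n = e (a n)\<close> only
  with some unit \<open>e\<close>, so the hypothesis is applied to \<open>e a\<close>.\<close>

lemma presimplifiable_localization:
  assumes pre: "presimplifiable R M S'"
  shows "presimplifiable RS MS T"
  unfolding presimplifiable_def
proof (intro ballI impI)
  fix x y assume x: "x \<in> T" and y: "y \<in> carrier MS" and eq: "x \<odot>\<^bsub>MS\<^esub> y = y"
  show "x \<in> Units RS \<or> y = \<zero>\<^bsub>MS\<^esub>"
  proof (rule disjCI)
    assume "y \<noteq> \<zero>\<^bsub>MS\<^esub>"
    then have nz: "x \<odot>\<^bsub>MS\<^esub> y \<noteq> \<zero>\<^bsub>MS\<^esub>"
      using eq by simp
    obtain a where a: "a \<in> S'" "lifts x a"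
      using lifts_ex[OF x y nz] by blast
    obtain n where n: "mlifts y n"
      using mlifts_ex y \<open>y \<noteq> \<zero>\<^bsub>MS\<^esub>\<close> by blast
    have "mlifts y (a \<odot>\<^bsub>M\<^esub> n)"
      using lifts_smult[OF a(2) n nz] eq by simp
    then obtain e where e: "e \<in> Units R" "n = e \<odot>\<^bsub>M\<^esub> (a \<odot>\<^bsub>M\<^esub> n)"
      using mlifts_unique n by blast
    have "mprim n"
      using n by (rule mliftsE)
    then have nn: "n \<in> carrier M" "n \<noteq> \<zero>\<^bsub>M\<^esub>"
      using mprimD by blast+
    have ea: "e \<otimes> a \<in> S'"
      using e(1) a(1) Units_subset' by auto
    have "(e \<otimes> a) \<odot>\<^bsub>M\<^esub> n = e \<odot>\<^bsub>M\<^esub> (a \<odot>\<^bsub>M\<^esub> n)"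
      using e(1) a(1) nn(1) by (simp add: R.Units_closed smult_assoc1)
    also have "\<dots> = n"
      by (rule e(2)[symmetric])
    finally have "e \<otimes> a \<in> Units R"
      using pre ea nn unfolding presimplifiable_def by blast
    then have "a \<in> Units R"
      using Units_factor[of a e] e(1) a(1) by (simp add: R.Units_closed R.m_comm)
    then show "x \<in> Units RS"
      using lifts_Units_iff[OF a(2)] by blast
  qed
qed

end

section \<open>Assembly of the equivalences\<close>

context splitting_pair
begin

text \<open>That \<open>s / 1\<close> is a unit of the localization only says that \<open>s\<close>
  lies in \<open>S\<close>; \<open>S_presimplifiable\<close> turns this into a unit of
  \<open>R\<close>.\<close>

lemma presimplifiable_join:
  assumes pre: "presimplifiable RS MS T"
  shows "presimplifiable R M S'"
  unfolding presimplifiable_def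
proof (intro ballI impI)
  fix s m assume s: "s \<in> S'" and m: "m \<in> carrier M" and eq: "s \<odot>\<^bsub>M\<^esub> m = m"
  have "frac s \<one> \<odot>\<^bsub>MS\<^esub> mfrac m \<one> = mfrac m \<one>"
    using s m eq by (simp add: loc_frac_smult)
  moreover have "frac s \<one> \<in> T" "mfrac m \<one> \<in> carrier MS"
    using s m by (simp_all add: frac_in_T_iff)
  ultimately have "frac s \<one> \<in> Units RS \<or> mfrac m \<one> = \<zero>\<^bsub>MS\<^esub>"
    using pre unfolding presimplifiable_def by blast
  then have "s \<in> S \<or> m = \<zero>\<^bsub>M\<^esub>"
    using s m by (simp add: frac_Units_iff mfrac_zero_iff)
  then show "s \<in> Units R \<or> m = \<zero>\<^bsub>M\<^esub>"
    using S_presimplifiable[OF _ m _ eq] by blast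
qed

lemma compact_if_bounded:
  assumes "bounded_factorization R M S"
  shows "compact_splitting_pair R M S S'"
proof unfold_locales
  fix a assume "a \<in> S'" "a \<in> live"
  then show "\<exists>s\<in>S. \<exists>b. rprim b \<and> a = s \<otimes> b"
    using bounded_imp_compactly_atomic[OF assms] by blast
qed

lemma compact_if_compactly_atomic:
  assumes "compactly_atomic (self_module R) S (S' - annihilator R M (carrier M))"
  shows "compact_splitting_pair R M S S'"
proof unfold_locales
  fix a assume a: "a \<in> S'" "a \<in> live"
  have "a \<noteq> \<zero>"
  proof
    assume "a = \<zero>"
    then show False
      using a(2) by (simp add: live_iff)
  qed
  then have "a \<in> S' - annihilator R M (carrier M) - {\<zero>\<^bsub>self_module R\<^esub>}"
    using a unfolding live_def self_module_simps by blast
  then have "compact_atomic_factorizations (self_module R) S a \<noteq> {}"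
    using assms unfolding compactly_atomic_def by blast
  then obtain s b where s: "s \<in> S" "S_primitive (self_module R) S b" "a = s \<otimes> b"
    unfolding compact_atomic_factorizations_def self_module_simps by blast
  have "b \<in> carrier R"
    using s(2) unfolding S_primitive_def self_module_simps by blast
  then have "b \<in> live"
    using live_factor(2)[OF _ S_R[OF s(1)]] a(2)[unfolded s(3)] by blast
  then show "\<exists>s\<in>S. \<exists>b. rprim b \<and> a = s \<otimes> b"
    using s S_primitive_imp_rprim by blast
qed

text \<open>Passing to fractions needs primitive parts of scalars, which follow from the property
  for \<open>S\<close>. Both sides contain that property, the left one by
  \<open>few_types_split\<close>.\<close>

lemma few_types_iff:
  "few_types k l R M S' (carrier M - {\<zero>\<^bsub>M\<^esub>}) \<longleftrightarrow>
    few_types k l R M S (carrier M - {\<zero>\<^bsub>M\<^esub>}) \<and>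
    few_types k l RS MS T (carrier MS - {\<zero>\<^bsub>MS\<^esub>})"
proof -
  have "few_types k l RS MS T (carrier MS - {\<zero>\<^bsub>MS\<^esub>}) \<longleftrightarrow> few_types k l R M S' {p. mprim p}"
    if "few_types k l R M S (carrier M - {\<zero>\<^bsub>M\<^esub>})"
    using compact_splitting_pair.few_types_localization compact_if_bounded few_types_imp_bounded that
    by blast
  then show ?thesis
    unfolding few_types_split by blast
qed

lemma bounded_factorization_iff:
  "bounded_factorization R M S' \<longleftrightarrow> bounded_factorization R M S \<and> bounded_factorization RS MS T"
  using bounded_split_imp bounded_join compact_splitting_pair.bounded_localization compact_if_bounded
  by blast

lemma presimplifiable_iff:
  assumes "compactly_atomic (self_module R) S (S' - annihilator R M (carrier M))"
  shows "presimplifiable R M S' \<longleftrightarrow> presimplifiable R M S \<and> presimplifiable RS MS T"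
proof -
  have "presimplifiable R M S"
    unfolding presimplifiable_def using S_presimplifiable by blast
  then show ?thesis
    using presimplifiable_join compact_if_compactly_atomic[OF assms]
      compact_splitting_pair.presimplifiable_localization by blast
qed

end

theorem theorem4p8:
  fixes R :: "('a, 'c) ring_scheme" and M :: "('a, 'm, 'd) module_scheme"
    and S S' :: "'a set"
  assumes "module R M" and "carrier M \<noteq> {\<zero>\<^bsub>M\<^esub>}"
    and "saturated_mult R S" and "saturated_mult R S'" and "S \<subseteq> S'"
    and "splits R M S (carrier M)"
    and "S \<inter> zero_divisors R M (carrier M) = {}"
    and "S \<inter> zero_divisors R (self_module R) (carrier R) = {}"
  shows
    "(unique_factorization R M S' \<longleftrightarrow>
        unique_factorization R M S \<and>
        unique_factorization (loc_ring R S) (loc_module R M S) (loc_subset R S S')) \<and>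
     (finite_factorization R M S' \<longleftrightarrow>
        finite_factorization R M S \<and>
        finite_factorization (loc_ring R S) (loc_module R M S) (loc_subset R S S')) \<and>
     (half_factorial R M S' \<longleftrightarrow>
        half_factorial R M S \<and>
        half_factorial (loc_ring R S) (loc_module R M S) (loc_subset R S S')) \<and>
     (bounded_factorization R M S' \<longleftrightarrow>
        bounded_factorization R M S \<and>
        bounded_factorization (loc_ring R S) (loc_module R M S) (loc_subset R S S')) \<and>
     (compactly_atomic (self_module R) S (S' - annihilator R M (carrier M)) \<longrightarrow>
        (presimplifiable R M S' \<longleftrightarrow>
           presimplifiable R M S \<and>
           presimplifiable (loc_ring R S) (loc_module R M S) (loc_subset R S S')))"
proof -
  interpret module_loc R M S
    using assms(1,3) by (simp add: module_loc_def saturated_mult_def)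
  interpret splitting_pair R M S S'
    by unfold_locales (use assms in simp_all)
  show ?thesis
    unfolding unique_factorization_iff finite_factorization_iff half_factorial_iff
      S'.unique_factorization_iff S'.finite_factorization_iff S'.half_factorial_iff
      RS.unique_factorization_iff RS.finite_factorization_iff RS.half_factorial_iff
    using few_types_iff bounded_factorization_iff presimplifiable_iff by blast
qed

end
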